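(* Let $d\ge 3$ be an integer, let $0<t\le\pi$, and let $\delta\ge\lceil \frac d2\rceil$ be a real number. Then the function $\theta\mapsto(t-\theta)_+^\delta$ on $[0,\pi]$ is strictly positive definite on the sphere $\mathbb{S}^{d-1}$.
   Context: $\mathbb{S}^{d-1}$ is the unit sphere of $\mathbb{R}^d$ with geodesic distance $\mathrm{d}(x,y)=\arccos\langle x,y\rangle$. A continuous function $g:[0,\pi]\to\mathbb{R}$ is strictly positive definite on $\mathbb{S}^{d-1}$ if for every $N\in\mathbb{N}$ and all distinct points $x_1,\dots,x_N\in\mathbb{S}^{d-1}$ the $N\times N$ matrix $[g(\mathrm{d}(x_i,x_j))]_{i,j=1}^N$ is positive definite. Here $(t-\theta)_+^\delta=(t-\theta)^\delta$ if $\theta\le t$ and $0$ if $\theta>t$. *)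

theory Defs
  imports "HOL-Analysis.Analysis" "Jordan_Normal_Form.Matrix"
begin

definition positive_definite_mat :: "real mat \<Rightarrow> bool" where
  "positive_definite_mat A \<longleftrightarrow>
     square_mat A \<and> transpose_mat A = A \<and>
     (\<forall>v \<in> carrier_vec (dim_row A). v \<noteq> 0\<^sub>v (dim_row A) \<longrightarrow> scalar_prod v (A *\<^sub>v v) > 0)"

definition geodesic_dist :: "real ^ 'n \<Rightarrow> real ^ 'n \<Rightarrow> real" where
  "geodesic_dist x y = arccos (inner x y)"

(* The sphere is the unit sphere of real ^ 'n, that is, of dimension CARD('n) - 1;
   only the values of g on [0, pi] matter. The N points are indexed by 0, ..., N - 1. *)
definition strictly_positive_definite_sphere ::
    "('n::finite) itself \<Rightarrow> (real \<Rightarrow> real) \<Rightarrow> bool" where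
  "strictly_positive_definite_sphere _ g \<longleftrightarrow>
     continuous_on {0..pi} g \<and>
     (\<forall>(N::nat) (x :: nat \<Rightarrow> real ^ 'n).
        (\<forall>i<N. x i \<in> sphere 0 1) \<and> inj_on x {..<N} \<longrightarrow>
        positive_definite_mat (Matrix.mat N N (\<lambda>(i, j). g (geodesic_dist (x i) (x j)))))"

definition truncated_power :: "real \<Rightarrow> real \<Rightarrow> real \<Rightarrow> real" where
  "truncated_power t \<delta> \<theta> = (if \<theta> \<le> t then (t - \<theta>) powr \<delta> else 0)"

end

(*
  By isometric embedding the ambient dimension may be taken even, equal to 2 k with
  k = ceiling (d / 2).  The volume of a ball cut by the half-spaces {x. 1 <= x . u1} and
  {x. 1 <= x . u2} is a positive definite function of the angle theta between u1 and u2.  Averaging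
  over the rotations of the plane of u1 and u2 shows that, for the ball of radius sqrt (1 + u), it
  is a constant multiple of the integral of (u - w)^(k - 1) (s(w) - theta)_+ over w in {0..u}, where
  s(w) = 2 arctan (sqrt w).  The quadratic form of this volume is moreover increasing in u, because
  it is the integral of a square over a growing ball, so the corresponding form with exponent
  k - 2 is nonnegative as well.  On the other hand (t - theta)_+^delta is the integral of
  f(w) (s(w) - theta)_+ with f(w) = const * (t - s(w))^(delta - 2) s'(w), and since s' is completely
  monotone the derivatives of f up to order k - 1 alternate in sign.  Integrating by parts k - 1
  times exhibits the quadratic form of (t - theta)_+^delta as an integral of nonnegative quantities.

  Strictness: if the form vanishes at c, then by the Cauchy-Schwarz inequality the function
  sum_j c_j (t - d(x, x_j))_+^delta vanishes on the whole sphere.  Along a geodesic through x_p its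
  p-th term has a corner at x_p, while all other terms are differentiable there; hence c_p = 0.
*)
theory Submission
  imports Defs
begin

no_notation scalar_prod (infix \<open>\<bullet>\<close> 70)

section \<open>Orthogonal transformations and Lebesgue measure\<close>

text \<open>Boxes determine Lebesgue measure, and the preimage of a box is its image under the
  inverse map, again orthogonal and so volume preserving. This serves both to move two vectors into
  coordinate position and to average over rotations.\<close>

lemma lborel_distr_orthogonal_transformation:
  fixes T :: "real^'m::{finite,wellorder} \<Rightarrow> real^'m::_"
  assumes T: "orthogonal_transformation T"
  shows "distr lborel borel T = lborel"
proof (rule lborel_eqI[symmetric])
  have meas: "T \<in> borel_measurable borel"
    by (intro borel_measurable_continuous_onI linear_continuous_on)
       (simp add: T orthogonal_transformation_linear linear_conv_bounded_linear[symmetric])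
  fix l u :: "real^'m::_"
  have "inj T" "surj T"
    using T orthogonal_transformation_inj orthogonal_transformation_surj by blast+
  then have pre: "T -` box l u = inv_into UNIV T ` box l u"
    by (simp add: bij_def bij_vimage_eq_inv_image)
  have inv: "orthogonal_transformation (inv_into UNIV T)"
    by (rule orthogonal_transformation_inv[OF T])
  have lm: "inv_into UNIV T ` box l u \<in> lmeasurable"
    by (rule measurable_orthogonal_image[OF inv]) simp
  have bor: "T -` box l u \<in> sets borel"
    using measurable_sets[OF meas, of "box l u"] by simp
  have "emeasure (distr lborel borel T) (box l u) = emeasure lborel (T -` box l u)"
    using meas by (subst emeasure_distr) auto
  also have "\<dots> = emeasure lebesgue (inv_into UNIV T ` box l u)"
    using bor pre by (simp add: emeasure_completion)
  also have "\<dots> = ennreal (measure lebesgue (inv_into UNIV T ` box l u))"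
    using lm by (simp add: emeasure_eq_measure2)
  also have "\<dots> = ennreal (measure lebesgue (box l u))"
    by (subst measure_orthogonal_image[OF inv]) auto
  also have "\<dots> = emeasure lborel (box l u)"
    by (metis emeasure_eq_measure2 fmeasurable_box measure_completion lborelD box_borel)
  finally show "emeasure (distr lborel borel T) (box l u) = (\<Prod>b\<in>Basis. (u - l) \<bullet> b)"
    if "\<And>b. b \<in> Basis \<Longrightarrow> l \<bullet> b \<le> u \<bullet> b"
    using that by (simp add: emeasure_lborel_box)
qed simp

section \<open>Reflections and plane rotations\<close>

definition reflection :: "'a::real_inner \<Rightarrow> 'a \<Rightarrow> 'a" where
  "reflection n x = x - (2 * (x \<bullet> n) / (n \<bullet> n)) *\<^sub>R n"

lemma orthogonal_transformation_reflection: "orthogonal_transformation (reflection n)"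
  unfolding orthogonal_transformation_def
proof (intro conjI allI)
  show "linear (reflection n)"
    by (rule linearI) (auto simp: reflection_def algebra_simps add_divide_distrib)
  show "reflection n v \<bullet> reflection n w = v \<bullet> w" for v w
    by (cases "n = 0") (auto simp: reflection_def inner_diff_left inner_diff_right inner_commute field_simps)
qed

text \<open>Equal norms make \<open>a + b\<close> orthogonal to \<open>a - b\<close>, so the
  coefficient of \<open>a - b\<close> in the reflection is exactly 1.\<close>

lemma reflection_swap:
  assumes "norm a = norm b"
  shows "reflection (a - b) a = b"
proof (cases "a = b")
  case False
  have "a \<bullet> a = b \<bullet> b"
    using assms by (simp add: norm_eq)
  then have "(a - b) \<bullet> (a - b) = 2 * (a \<bullet> (a - b))"
    by (simp add: inner_diff_left inner_diff_right inner_commute)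
  moreover have "(a - b) \<bullet> (a - b) \<noteq> 0" using False by simp
  ultimately show ?thesis by (simp add: reflection_def)
qed (simp add: reflection_def)

lemma reflection_fix: "n \<bullet> x = 0 \<Longrightarrow> reflection n x = x"
  by (simp add: reflection_def inner_commute)

text \<open>Two reflections suffice: the first carries \<open>u1\<close> to \<open>b1\<close>, the
  second turns the part of the image of \<open>u2\<close> orthogonal to \<open>b1\<close> into the
  direction \<open>b2\<close>.\<close>

lemma orthogonal_transformation_align_plane:
  fixes u1 u2 b1 b2 :: "'a::real_inner"
  assumes "norm u1 = 1" "norm u2 = 1" "norm b1 = 1" "norm b2 = 1" "b1 \<bullet> b2 = 0"
  obtains T where "orthogonal_transformation T" "T u1 = b1"
    "T u2 = cos (arccos (u1 \<bullet> u2)) *\<^sub>R b1 + sin (arccos (u1 \<bullet> u2)) *\<^sub>R b2"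
proof -
  define c where "c = u1 \<bullet> u2"
  have c: "-1 \<le> c" "c \<le> 1"
    using Cauchy_Schwarz_ineq2[of u1 u2] assms by (auto simp: c_def abs_le_iff)
  define T1 where "T1 = reflection (u1 - b1)"
  have T1: "orthogonal_transformation T1" "T1 u1 = b1"
    using assms by (simp_all add: T1_def orthogonal_transformation_reflection reflection_swap)
  have c': "T1 u2 \<bullet> b1 = c"
    using T1 by (metis c_def inner_commute orthogonal_transformation_def)
  have n': "T1 u2 \<bullet> T1 u2 = 1"
    using T1 assms by (metis norm_eq_1 orthogonal_transformation_def)
  define z where "z = T1 u2 - c *\<^sub>R b1"
  have b11: "b1 \<bullet> b1 = 1" using assms by (simp add: norm_eq_1)
  have zb: "z \<bullet> b1 = 0" using b11 by (simp add: z_def inner_diff_left c')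
  have "z \<bullet> z = 1 - c\<^sup>2"
    using b11 n' c' by (simp add: z_def inner_diff_left inner_diff_right inner_commute power2_eq_square algebra_simps)
  then have nz: "norm z = sin (arccos c)"
    using c by (simp add: norm_eq_sqrt_inner sin_arccos)
  \<comment> \<open>Both \<open>z\<close> and \<open>norm z *\<^sub>R b2\<close> are orthogonal to
    \<open>b1\<close>, so this reflection leaves \<open>b1\<close> in place. If \<open>u2\<close> is
    parallel to \<open>u1\<close>, then \<open>z = 0\<close> and the reflection is the
    identity.\<close>
  define T2 where "T2 = reflection (z - norm z *\<^sub>R b2)"
  have T2: "orthogonal_transformation T2" "T2 z = norm z *\<^sub>R b2" "T2 b1 = b1"
    using assms zb by (auto simp: T2_def orthogonal_transformation_reflection inner_commute inner_diff_right
        inner_diff_left intro!: reflection_swap reflection_fix)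
  have "linear T2" using T2 orthogonal_transformation_linear by blast
  have "T1 u2 = c *\<^sub>R b1 + z" by (simp add: z_def)
  then have "T2 (T1 u2) = c *\<^sub>R b1 + norm z *\<^sub>R b2"
    using \<open>linear T2\<close> T2 by (simp add: linear_add linear_scale)
  then show thesis
    using that[of "T2 \<circ> T1"] T1 T2 nz c
    by (simp add: orthogonal_transformation_compose c_def cos_arccos)
qed

text \<open>Writing the rotation as a correction of \<open>x\<close> fixes the orthogonal complement
  of the plane without a projection onto it.\<close>

definition plane_rotation :: "'a::real_inner \<Rightarrow> 'a \<Rightarrow> real \<Rightarrow> 'a \<Rightarrow> 'a" where
  "plane_rotation b1 b2 \<phi> x = x +
     ((cos \<phi> - 1) * (x \<bullet> b1) - sin \<phi> * (x \<bullet> b2)) *\<^sub>R b1 +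
     ((cos \<phi> - 1) * (x \<bullet> b2) + sin \<phi> * (x \<bullet> b1)) *\<^sub>R b2"

lemma
  fixes b1 b2 :: "'a::real_inner"
  assumes b: "norm b1 = 1" "norm b2 = 1" "b1 \<bullet> b2 = 0"
  shows orthogonal_transformation_plane_rotation: "orthogonal_transformation (plane_rotation b1 b2 \<phi>)"
    and plane_rotation_inner_1: "plane_rotation b1 b2 \<phi> x \<bullet> b1 = cos \<phi> * (x \<bullet> b1) - sin \<phi> * (x \<bullet> b2)"
    and plane_rotation_inner_2: "plane_rotation b1 b2 \<phi> x \<bullet> b2 = cos \<phi> * (x \<bullet> b2) + sin \<phi> * (x \<bullet> b1)"
proof -
  have [simp]: "b1 \<bullet> b1 = 1" "b2 \<bullet> b2 = 1" "b2 \<bullet> b1 = 0" "b1 \<bullet> b2 = 0"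
    using b by (simp_all add: norm_eq_1 inner_commute)
  show "orthogonal_transformation (plane_rotation b1 b2 \<phi>)"
    unfolding orthogonal_transformation_def
  proof (intro conjI allI)
    show "linear (plane_rotation b1 b2 \<phi>)"
      by (rule linearI) (auto simp: plane_rotation_def algebra_simps)
    fix v w
    define p q r s C S where pq: "p = v \<bullet> b1" "q = v \<bullet> b2" "r = w \<bullet> b1" "s = w \<bullet> b2" "C = cos \<phi>" "S = sin \<phi>"
    have [simp]: "b1 \<bullet> v = p" "b2 \<bullet> v = q" "b1 \<bullet> w = r" "b2 \<bullet> w = s" by (simp_all add: pq inner_commute)
    have CS: "S\<^sup>2 = 1 - C\<^sup>2" by (simp add: pq sin_squared_eq)
    have "plane_rotation b1 b2 \<phi> v \<bullet> plane_rotation b1 b2 \<phi> w - v \<bullet> w =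
       ((C - 1) * p - S * q) * r + ((C - 1) * q + S * p) * s +
       ((C - 1) * r - S * s) * p + ((C - 1) * s + S * r) * q +
       ((C - 1) * p - S * q) * ((C - 1) * r - S * s) + ((C - 1) * q + S * p) * ((C - 1) * s + S * r)"
      unfolding plane_rotation_def
      by (simp add: inner_add_left inner_add_right pq[symmetric]) (simp add: algebra_simps)
    \<comment> \<open>The whole defect is a multiple of the single relation between \<open>C\<close>
      and \<open>S\<close>, treated as independent up to here.\<close>
    also have "\<dots> = (S\<^sup>2 - (1 - C\<^sup>2)) * (p * r + q * s)"
      by (simp add: power2_eq_square algebra_simps)
    finally show "plane_rotation b1 b2 \<phi> v \<bullet> plane_rotation b1 b2 \<phi> w = v \<bullet> w"
      using CS by simp
  qed
  show "plane_rotation b1 b2 \<phi> x \<bullet> b1 = cos \<phi> * (x \<bullet> b1) - sin \<phi> * (x \<bullet> b2)"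
    "plane_rotation b1 b2 \<phi> x \<bullet> b2 = cos \<phi> * (x \<bullet> b2) + sin \<phi> * (x \<bullet> b1)"
    by (simp_all add: plane_rotation_def inner_add_left algebra_simps)
qed

section \<open>Volume of a ball cut by two half-spaces\<close>

lemma nn_integral_periodic:
  fixes f :: "real \<Rightarrow> ennreal"
  assumes [measurable]: "f \<in> borel_measurable borel"
    and per: "\<And>x. f (x + p) = f x" and p: "0 \<le> c" "c \<le> p"
  shows "(\<integral>\<^sup>+x. f (x + c) * indicator {a..<a+p} x \<partial>lborel) = (\<integral>\<^sup>+x. f x * indicator {a..<a+p} x \<partial>lborel)"
proof -
  have shift: "(\<integral>\<^sup>+x. f x * indicator {l + d..<u + d} x \<partial>lborel) =
      (\<integral>\<^sup>+x. f (x + d) * indicator {l..<u} x \<partial>lborel)" for d l u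
    by (subst nn_integral_real_affine[of _ 1 d]) (auto simp: indicator_def add.commute intro!: nn_integral_cong)
  have "(\<integral>\<^sup>+x. f (x + c) * indicator {a..<a+p} x \<partial>lborel) = 
        (\<integral>\<^sup>+x. f x * indicator {a+c..<a+p+c} x \<partial>lborel)"
    by (rule shift[symmetric])
  \<comment> \<open>The shifted window is split at \<open>a + p\<close>, and the overhang is moved
    back by one period.\<close>
  also have "\<dots> = (\<integral>\<^sup>+x. f x * indicator {a+c..<a+p} x + f x * indicator {a+p..<a+c+p} x \<partial>lborel)"
    using p by (intro nn_integral_cong) (auto simp: indicator_def)
  also have "\<dots> = (\<integral>\<^sup>+x. f x * indicator {a+c..<a+p} x \<partial>lborel) + (\<integral>\<^sup>+x. f x * indicator {a..<a+c} x \<partial>lborel)"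
    by (subst nn_integral_add) (auto simp: shift per)
  also have "\<dots> = (\<integral>\<^sup>+x. f x * indicator {a+c..<a+p} x + f x * indicator {a..<a+c} x \<partial>lborel)"
    by (subst nn_integral_add) auto
  also have "\<dots> = (\<integral>\<^sup>+x. f x * indicator {a..<a+p} x \<partial>lborel)"
    using p by (intro nn_integral_cong) (auto simp: indicator_def)
  finally show ?thesis .
qed

lemma cos_ge_iff_arccos:
  assumes "0 < q" "q \<le> 1" "\<bar>\<phi>\<bar> \<le> pi"
  shows "q \<le> cos \<phi> \<longleftrightarrow> \<bar>\<phi>\<bar> \<le> arccos q"
proof -
  have "cos \<phi> = cos \<bar>\<phi>\<bar>" by simp
  moreover have "q = cos (arccos q)" using assms by simp
  moreover have "cos (arccos q) \<le> cos \<bar>\<phi>\<bar> \<longleftrightarrow> \<bar>\<phi>\<bar> \<le> arccos q"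
    using assms by (intro cos_mono_le_eq) (auto simp: arccos_lbound arccos_ubound)
  ultimately show ?thesis by simp
qed

text \<open>On a circle of radius \<open>r\<close> each half-plane cuts out the angles within
  \<open>arccos (1 / r)\<close> of its normal. This is less than \<open>pi / 2\<close>, so for
  \<theta> at most \<open>pi\<close> the two arcs cannot meet a second time on the far side: the
  overlap is one interval, possibly empty.\<close>

lemma arc_intersection:
  assumes r: "1 \<le> r" and \<theta>: "0 \<le> \<theta>" "\<theta> \<le> pi"
  shows "{\<phi>\<in>{-pi..<pi}. 1 \<le> r * cos \<phi> \<and> 1 \<le> r * cos (\<phi> - \<theta>)} = {\<theta> - arccos (1 / r)..arccos (1 / r)}"
proof -
  define q where "q = 1 / r"
  define \<beta> where "\<beta> = arccos q"
  have q: "0 < q" "q \<le> 1" using r by (auto simp: q_def)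
  have \<beta>: "0 \<le> \<beta>" "\<beta> < pi / 2"
    using q arccos_less_arccos[of 0 q] by (auto simp: \<beta>_def arccos_lbound)
  have ge: "1 \<le> r * cos x \<longleftrightarrow> q \<le> cos x" for x
    using r by (auto simp: q_def field_simps)
  have 1: "q \<le> cos \<phi> \<longleftrightarrow> \<bar>\<phi>\<bar> \<le> \<beta>" if "\<phi> \<in> {-pi..<pi}" for \<phi>
    using cos_ge_iff_arccos[OF q, of \<phi>] that by (auto simp: \<beta>_def)
  have 2: "q \<le> cos (\<phi> - \<theta>) \<longleftrightarrow> \<theta> - \<beta> \<le> \<phi>" if "\<bar>\<phi>\<bar> \<le> \<beta>" for \<phi>
  proof (cases "-pi \<le> \<phi> - \<theta>")
    case True
    then show ?thesis
      using cos_ge_iff_arccos[OF q, of "\<phi> - \<theta>"] that \<beta> \<theta> by (auto simp: \<beta>_def[symmetric])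
  next
    \<comment> \<open>Here both sides are false: after adding a full turn the angle is at least
      \<open>pi - \<beta>\<close>, which exceeds \<beta>.\<close>
    case False
    have "cos (\<phi> - \<theta>) = cos (\<phi> - \<theta> + 2 * pi)" by simp
    then show ?thesis
      using cos_ge_iff_arccos[OF q, of "\<phi> - \<theta> + 2 * pi"] that \<beta> \<theta> False
      by (auto simp: \<beta>_def[symmetric] simp del: cos_periodic)
  qed
  show ?thesis
    unfolding ge q_def[symmetric] \<beta>_def[symmetric]
    using 1 2 \<beta> \<theta> by fastforce
qed

text \<open>Each of the two half-planes cuts an arc of angle \<open>2 * arctan (sqrt w)\<close> out of the circle of radius
  \<open>sqrt (1 + w)\<close>; the arcs overlap in the angle \<open>lens \<theta> w\<close>.\<close>

definition lens :: "real \<Rightarrow> real \<Rightarrow> real" where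
  "lens \<theta> w = max 0 (2 * arctan (sqrt w) - \<theta>)"

lemma continuous_on_lens [continuous_intros]:
  "continuous_on S f \<Longrightarrow> continuous_on S (\<lambda>x. lens \<theta> (f x))"
  unfolding lens_def by (intro continuous_intros)

lemma lens_nonneg [simp]: "0 \<le> lens \<theta> w"
  by (simp add: lens_def)

lemma borel_measurable_lens [measurable]: "lens \<theta> \<in> borel_measurable borel"
  by (intro borel_measurable_continuous_onI continuous_intros)

lemma arccos_inverse_sqrt:
  assumes "0 \<le> w"
  shows "arccos (1 / sqrt (1 + w)) = arctan (sqrt w)"
proof -
  have "cos (arctan (sqrt w)) = 1 / sqrt (1 + w)"
    using assms by (simp add: cos_arctan)
  moreover have "0 \<le> arctan (sqrt w)" "arctan (sqrt w) \<le> pi"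
    using assms arctan_ubound[of "sqrt w"] pi_gt_zero by (auto intro: less_imp_le simp del: pi_gt_zero)
  ultimately show ?thesis by (metis arccos_cos)
qed

text \<open>In polar coordinates a rotation by \<phi> adds \<phi> to the angle \<psi> of the point,
  and periodicity removes \<psi>. What remains is the length of the overlap of the two arcs; a
  circle of radius below 1 meets neither half-plane.\<close>

lemma nn_integral_arc_intersection:
  assumes \<theta>: "0 \<le> \<theta>" "\<theta> \<le> pi"
  shows "(\<integral>\<^sup>+\<phi>. indicator {\<phi>. 1 \<le> cos \<phi> * x - sin \<phi> * y \<and> 
             1 \<le> cos \<theta> * (cos \<phi> * x - sin \<phi> * y) + sin \<theta> * (cos \<phi> * y + sin \<phi> * x)} \<phi>
             * indicator {-pi..<pi} \<phi> \<partial>lborel) =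
         ennreal (indicator {1..} (x\<^sup>2 + y\<^sup>2) * lens \<theta> (x\<^sup>2 + y\<^sup>2 - 1))"
proof -
  define r where "r = sqrt (x\<^sup>2 + y\<^sup>2)"
  have r0: "r \<ge> 0" by (simp add: r_def)
  obtain \<psi> where \<psi>: "0 \<le> \<psi>" "\<psi> \<le> 2 * pi" "x = r * cos \<psi>" "y = r * sin \<psi>"
  proof (cases "r = 0")
    case True
    then have "x = 0" "y = 0" by (simp_all add: r_def)
    then show ?thesis using True that[of 0] by simp
  next
    case False
    then have "x\<^sup>2 + y\<^sup>2 \<noteq> 0" by (simp add: r_def)
    then have "(x / r)\<^sup>2 + (y / r)\<^sup>2 = 1"
      by (simp add: r_def power_divide add_divide_distrib[symmetric])
    then obtain t where "0 \<le> t" "t < 2 * pi" "x / r = cos t" "y / r = sin t"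
      using sincos_total_2pi by metis
    then show ?thesis using False that[of t] by (simp add: field_simps)
  qed
  define f :: "real \<Rightarrow> ennreal" where
    "f = indicator {\<phi>. 1 \<le> r * cos \<phi> \<and> 1 \<le> r * cos (\<phi> - \<theta>)}"
  have [measurable]: "f \<in> borel_measurable borel"
    unfolding f_def by measurable
  have e1: "cos \<phi> * x - sin \<phi> * y = r * cos (\<phi> + \<psi>)" for \<phi>
    by (simp add: \<psi> cos_add algebra_simps)
  have e2: "cos \<theta> * (cos \<phi> * x - sin \<phi> * y) + sin \<theta> * (cos \<phi> * y + sin \<phi> * x) = r * cos (\<phi> + \<psi> - \<theta>)" for \<phi>
    unfolding e1 cos_diff by (simp add: \<psi> sin_add algebra_simps)
  have "(\<integral>\<^sup>+\<phi>. indicator {\<phi>. 1 \<le> cos \<phi> * x - sin \<phi> * y \<and> 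
             1 \<le> cos \<theta> * (cos \<phi> * x - sin \<phi> * y) + sin \<theta> * (cos \<phi> * y + sin \<phi> * x)} \<phi>
             * indicator {-pi..<pi} \<phi> \<partial>lborel) =
        (\<integral>\<^sup>+\<phi>. f (\<phi> + \<psi>) * indicator {-pi..<-pi + 2 * pi} \<phi> \<partial>lborel)"
    unfolding e2 unfolding e1 by (intro nn_integral_cong) (auto simp: f_def indicator_def)
  also have "\<dots> = (\<integral>\<^sup>+\<phi>. f \<phi> * indicator {-pi..<-pi + 2 * pi} \<phi> \<partial>lborel)"
  proof (rule nn_integral_periodic)
    show "f (x + 2 * pi) = f x" for x
    proof -
      have "cos (x + 2 * pi - \<theta>) = cos (x - \<theta>)"
        using cos_periodic[of "x - \<theta>"] by (simp add: algebra_simps)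
      then show ?thesis by (simp add: f_def indicator_def)
    qed
  qed (use \<psi> in auto)
  also have "\<dots> = (\<integral>\<^sup>+\<phi>. indicator {\<phi>\<in>{-pi..<pi}. 1 \<le> r * cos \<phi> \<and> 1 \<le> r * cos (\<phi> - \<theta>)} \<phi> \<partial>lborel)"
    by (intro nn_integral_cong) (auto simp: f_def indicator_def)
  also have "\<dots> = ennreal (indicator {1..} (x\<^sup>2 + y\<^sup>2) * lens \<theta> (x\<^sup>2 + y\<^sup>2 - 1))"
  proof (cases "1 \<le> r")
    case True
    then have "1 \<le> x\<^sup>2 + y\<^sup>2" by (simp add: r_def)
    then have "arccos (1 / r) = arctan (sqrt (x\<^sup>2 + y\<^sup>2 - 1))"
      using arccos_inverse_sqrt[of "x\<^sup>2 + y\<^sup>2 - 1"] by (simp add: r_def)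
    then show ?thesis
      unfolding arc_intersection[OF True \<theta>] using \<open>1 \<le> x\<^sup>2 + y\<^sup>2\<close>
      by (auto simp: emeasure_lborel_Icc_eq lens_def max_def)
  next
    case False
    have "r * cos \<phi> < 1" for \<phi>
      using False r0 mult_left_mono[OF cos_le_one[of \<phi>], of r] by linarith
    then have "{\<phi>\<in>{-pi..<pi}. 1 \<le> r * cos \<phi> \<and> 1 \<le> r * cos (\<phi> - \<theta>)} = {}"
      by (auto simp: not_le[symmetric])
    moreover have "\<not> 1 \<le> x\<^sup>2 + y\<^sup>2" using False by (simp add: r_def)
    ultimately show ?thesis by simp
  qed
  finally show ?thesis .
qed

section \<open>Integrals over a ball of functions of the projection to a plane\<close>

lemma distr_sum_of_squares:
  "distr (lborel \<Otimes>\<^sub>M lborel) borel (\<lambda>(x::real, y::real). x\<^sup>2 + y\<^sup>2) = density lborel (\<lambda>\<tau>. ennreal pi * indicator {0..} \<tau>)"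
  (is "?M = ?N")
proof (rule measure_eqI_generator_eq)
  let ?E = "range (\<lambda>a::real. {..a})"
  show "Int_stable ?E" by (auto simp: Int_stable_def)
  show "?E \<subseteq> Pow UNIV" by simp
  show "sets ?M = sigma_sets UNIV ?E" "sets ?N = sigma_sets UNIV ?E"
    by (simp_all add: borel_eq_atMost)
  show "range (\<lambda>n::nat. {..real n}) \<subseteq> ?E" by auto
  show "(\<Union>n::nat. {..real n}) = UNIV" using real_arch_simple by auto
  have [measurable]: "(\<lambda>(x::real, y::real). x\<^sup>2 + y\<^sup>2) \<in> borel_measurable borel"
    unfolding split_beta by (intro borel_measurable_continuous_onI continuous_intros)
  \<comment> \<open>The disc of radius \<open>sqrt a\<close> has area \<open>pi * a\<close>, linear
    in \<open>a\<close>, which is why the density is constant.\<close>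
  have M: "emeasure ?M {..a} = ennreal (pi * max 0 a)" for a
  proof (cases "a \<ge> 0")
    case True
    have "emeasure ?M {..a} = emeasure (lborel :: (real \<times> real) measure) (cball 0 (sqrt a))"
      using True by (subst emeasure_distr)
        (auto simp: lborel_prod space_pair_measure vimage_def mem_cball_0 norm_Pair intro!: arg_cong2[where f=emeasure])
    also have "\<dots> = ennreal (pi * a)"
      using True by (simp add: emeasure_cball eval_unit_ball_vol)
    finally show ?thesis using True by simp
  next
    case False
    have "x\<^sup>2 + y\<^sup>2 > a" for x y :: real
      using False sum_power2_ge_zero[of x y] by linarith
    then have "(\<lambda>(x, y). x\<^sup>2 + y\<^sup>2) -` {..a} = ({} :: (real \<times> real) set)"
      by (fastforce simp: not_le[symmetric])
    then show ?thesis using False by (subst emeasure_distr) auto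
  qed
  have N: "emeasure ?N {..a} = ennreal (pi * max 0 a)" for a
  proof -
    have "emeasure ?N {..a} = (\<integral>\<^sup>+x. ennreal pi * indicator {0..a} x \<partial>lborel)"
      by (subst emeasure_density) (auto simp: indicator_def intro!: nn_integral_cong)
    then show ?thesis
      by (simp add: nn_integral_cmult emeasure_lborel_Icc_eq ennreal_mult' max_def)
  qed
  show "emeasure ?M X = emeasure ?N X" if "X \<in> ?E" for X
    using that M N by auto
  show "emeasure ?M {..real n} \<noteq> \<infinity>" for n
    by (simp add: M)
qed

lemma nn_integral_sum_of_squares:
  fixes F :: "real \<Rightarrow> ennreal"
  assumes [measurable]: "F \<in> borel_measurable borel"
  shows "(\<integral>\<^sup>+x. \<integral>\<^sup>+y. F (x\<^sup>2 + y\<^sup>2) \<partial>lborel \<partial>lborel) = ennreal pi * (\<integral>\<^sup>+\<tau>. F \<tau> * indicator {0..} \<tau> \<partial>lborel)"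
proof -
  interpret pair_sigma_finite "lborel :: real measure" "lborel :: real measure" ..
  have "(\<integral>\<^sup>+x. \<integral>\<^sup>+y. F (x\<^sup>2 + y\<^sup>2) \<partial>lborel \<partial>lborel) = (\<integral>\<^sup>+z. F ((\<lambda>(x, y). x\<^sup>2 + y\<^sup>2) z) \<partial>(lborel \<Otimes>\<^sub>M lborel))"
    by (subst lborel.nn_integral_fst[symmetric]) auto
  also have "\<dots> = (\<integral>\<^sup>+\<tau>. F \<tau> \<partial>distr (lborel \<Otimes>\<^sub>M lborel) borel (\<lambda>(x::real, y::real). x\<^sup>2 + y\<^sup>2))"
    by (subst nn_integral_distr) auto
  also have "\<dots> = ennreal pi * (\<integral>\<^sup>+\<tau>. F \<tau> * indicator {0..} \<tau> \<partial>lborel)"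
    unfolding distr_sum_of_squares
    by (subst nn_integral_density) (auto simp: nn_integral_cmult[symmetric] mult_ac intro!: nn_integral_cong)
  finally show ?thesis .
qed

lemma emeasure_PiM_ball:
  assumes "finite A" "A \<noteq> {}" "0 \<le> q"
  shows "emeasure (Pi\<^sub>M A (\<lambda>_. lborel)) ({f. (\<Sum>i\<in>A. (f i)\<^sup>2) \<le> q} \<inter> space (Pi\<^sub>M A (\<lambda>_. lborel))) =
           ennreal (unit_ball_vol (real (card A)) * sqrt q ^ card A)"
proof (cases "q = 0")
  case False
  then have "{f. (\<Sum>i\<in>A. (f i)\<^sup>2) \<le> q} = {f. sqrt (\<Sum>i\<in>A. (f i)\<^sup>2) \<le> sqrt q}" for f
    by simp
  then show ?thesis using emeasure_cball_aux[of A "sqrt q"] assms False by simp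
next
  case True
  interpret product_sigma_finite "\<lambda>_. lborel :: real measure" by standard
  \<comment> \<open>In radius 0 the ball lies in the single point 0, a null set because
    \<open>A\<close> is nonempty.\<close>
  have "{f. (\<Sum>i\<in>A. (f i)\<^sup>2) \<le> q} \<inter> space (Pi\<^sub>M A (\<lambda>_. lborel)) \<subseteq> (\<Pi>\<^sub>E i\<in>A. {0::real})"
  proof
    fix f assume f: "f \<in> {f. (\<Sum>i\<in>A. (f i)\<^sup>2) \<le> q} \<inter> space (Pi\<^sub>M A (\<lambda>_. lborel))"
    then have "(\<Sum>i\<in>A. (f i)\<^sup>2) = 0"
      using True by (auto intro!: antisym sum_nonneg)
    then have "\<forall>i\<in>A. f i = 0"
      using \<open>finite A\<close> by (subst (asm) sum_nonneg_eq_0_iff) auto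
    then show "f \<in> (\<Pi>\<^sub>E i\<in>A. {0})"
      using f by (auto simp: space_PiM PiE_def extensional_def fun_eq_iff)
  qed
  then have "emeasure (Pi\<^sub>M A (\<lambda>_. lborel)) ({f. (\<Sum>i\<in>A. (f i)\<^sup>2) \<le> q} \<inter> space (Pi\<^sub>M A (\<lambda>_. lborel)))
     \<le> emeasure (Pi\<^sub>M A (\<lambda>_. lborel)) (\<Pi>\<^sub>E i\<in>A. {0::real})"
    using assms by (intro emeasure_mono sets_PiM_I_finite) auto
  also have "\<dots> = 0" using assms by (subst emeasure_PiM) (auto simp: prod_constant)
  finally show ?thesis using assms True by (simp add: card_gt_0_iff)
qed

text \<open>By Fubini: above a point of the plane at squared distance \<tau> from the origin lies a
  ball of dimension \<open>2 * k - 2\<close> and squared radius \<open>q - \<tau>\<close>. As this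
  dimension is even, its volume is a constant times an integer power of \<open>q - \<tau>\<close>,
  the kernel of an iterated primitive.\<close>

lemma nn_integral_ball_plane_projection:
  fixes b1 b2 :: "'a::euclidean_space" and F :: "real \<Rightarrow> ennreal"
  assumes b: "b1 \<in> Basis" "b2 \<in> Basis" "b1 \<noteq> b2" and dim: "DIM('a) = 2 * k" "k \<ge> 2"
    and [measurable]: "F \<in> borel_measurable borel"
  shows "(\<integral>\<^sup>+x. F ((x \<bullet> b1)\<^sup>2 + (x \<bullet> b2)\<^sup>2) * indicator {x::'a. x \<bullet> x \<le> q} x \<partial>lborel) =
     ennreal (unit_ball_vol (real (2 * k - 2)) * pi) *
       (\<integral>\<^sup>+\<tau>. F \<tau> * ennreal ((q - \<tau>) ^ (k - 1)) * indicator {0..q} \<tau> \<partial>lborel)"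
proof -
  interpret product_sigma_finite "\<lambda>_. lborel :: real measure" by standard
  define R where "R = Basis - {b1, b2}"
  have R: "finite R" "b1 \<notin> insert b2 R" "b2 \<notin> R" "Basis = insert b1 (insert b2 R)"
    using b by (auto simp: R_def)
  have "card (Basis :: 'a set) = Suc (Suc (card R))"
    unfolding R(4) using R(1-3) by simp
  then have card: "card R = 2 * (k - 1)" using dim by simp
  have "R \<noteq> {}" using card dim by auto
  define V where "V = unit_ball_vol (real (2 * k - 2))"
  have V0: "V \<ge> 0" by (simp add: V_def)
  have cardV: "unit_ball_vol (real (card R)) = V"
    using card dim by (simp add: V_def diff_mult_distrib2)
  \<comment> \<open>\<open>G\<close> is the integrand in coordinates, and \<open>H\<close> is what
    remains of it once the coordinates in \<open>R\<close> are integrated out.\<close>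
  define G where "G f = F ((f b1)\<^sup>2 + (f b2)\<^sup>2) * indicator {f. (f b1)\<^sup>2 + (f b2)\<^sup>2 + (\<Sum>b\<in>R. (f b)\<^sup>2) \<le> q} f" for f
  define H where "H \<tau> = F \<tau> * (ennreal (V * (q - \<tau>) ^ (k - 1)) * indicator {..q} \<tau>)" for \<tau>
  have inn: "(\<Sum>b'\<in>Basis. f b' *\<^sub>R b') \<bullet> b = f b" if "b \<in> Basis" for f and b :: 'a
    using that by (simp add: inner_sum_left inner_Basis if_distrib cong: if_cong)
  have "(\<integral>\<^sup>+x. F ((x \<bullet> b1)\<^sup>2 + (x \<bullet> b2)\<^sup>2) * indicator {x::'a. x \<bullet> x \<le> q} x \<partial>lborel) =
    (\<integral>\<^sup>+f. G f \<partial>Pi\<^sub>M (Basis :: 'a set) (\<lambda>_. lborel))"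
  proof (subst lborel_eq, subst nn_integral_distr)
    have "(\<Sum>b'\<in>Basis. f b' *\<^sub>R b') \<bullet> (\<Sum>b'\<in>Basis. f b' *\<^sub>R b') = (f b1)\<^sup>2 + (f b2)\<^sup>2 + (\<Sum>b\<in>R. (f b)\<^sup>2)" for f :: "'a \<Rightarrow> real"
    proof -
      have "(\<Sum>b'\<in>Basis. f b' *\<^sub>R b') \<bullet> (\<Sum>b'\<in>Basis. f b' *\<^sub>R b') = (\<Sum>b\<in>Basis. (f b)\<^sup>2)"
        by (subst euclidean_inner) (simp add: inn power2_eq_square)
      then show ?thesis unfolding R(4) using R(1-3) by (simp add: add.assoc)
    qed
    then show "(\<integral>\<^sup>+f. F (((\<Sum>b'\<in>Basis. f b' *\<^sub>R b') \<bullet> b1)\<^sup>2 + ((\<Sum>b'\<in>Basis. f b' *\<^sub>R b') \<bullet> b2)\<^sup>2) *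
       indicator {x. x \<bullet> x \<le> q} (\<Sum>b'\<in>Basis. f b' *\<^sub>R b') \<partial>Pi\<^sub>M (Basis :: 'a set) (\<lambda>_. lborel)) =
       (\<integral>\<^sup>+f. G f \<partial>Pi\<^sub>M (Basis :: 'a set) (\<lambda>_. lborel))"
      using b by (intro nn_integral_cong) (auto simp: G_def inn indicator_def)
  next
    show "(\<lambda>f. \<Sum>b\<in>Basis. f b *\<^sub>R b :: 'a) \<in> Pi\<^sub>M Basis (\<lambda>_. lborel) \<rightarrow>\<^sub>M borel"
      by simp
    have "{x::'a. x \<bullet> x \<le> q} \<in> sets borel" by simp
    then show "(\<lambda>x::'a. F ((x \<bullet> b1)\<^sup>2 + (x \<bullet> b2)\<^sup>2) * indicator {x. x \<bullet> x \<le> q} x)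
       \<in> borel_measurable (distr (Pi\<^sub>M Basis (\<lambda>_. lborel)) borel (\<lambda>f. \<Sum>b\<in>Basis. f b *\<^sub>R b))"
      by simp
  qed
  also have "\<dots> = (\<integral>\<^sup>+x. \<integral>\<^sup>+y. \<integral>\<^sup>+z. G (z(b2 := y, b1 := x)) \<partial>Pi\<^sub>M R (\<lambda>_. lborel) \<partial>lborel \<partial>lborel)"
  proof -
    have [measurable]: "G \<in> borel_measurable (Pi\<^sub>M (insert b1 (insert b2 R)) (\<lambda>_. lborel))"
      unfolding G_def using R(1) by measurable
    show ?thesis
      unfolding R(4) using R(1-3)
      by (subst product_nn_integral_insert_rev, simp, simp, simp, intro nn_integral_cong,
          subst product_nn_integral_insert_rev) (auto simp: fun_upd_twist)
  qed
  also have "\<dots> = (\<integral>\<^sup>+x. \<integral>\<^sup>+y. H (x\<^sup>2 + y\<^sup>2) \<partial>lborel \<partial>lborel)"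
  proof (intro nn_integral_cong)
    fix x y :: real
    define \<tau> where "\<tau> = x\<^sup>2 + y\<^sup>2"
    have "(\<integral>\<^sup>+z. G (z(b2 := y, b1 := x)) \<partial>Pi\<^sub>M R (\<lambda>_. lborel)) =
       (\<integral>\<^sup>+z. F \<tau> * indicator ({f. (\<Sum>b\<in>R. (f b)\<^sup>2) \<le> q - \<tau>} \<inter> space (Pi\<^sub>M R (\<lambda>_. lborel))) z \<partial>Pi\<^sub>M R (\<lambda>_. lborel))"
    proof (intro nn_integral_cong)
      fix z :: "'a \<Rightarrow> real" assume z: "z \<in> space (Pi\<^sub>M R (\<lambda>_. lborel))"
      have "(\<Sum>b\<in>R. ((z(b2 := y, b1 := x)) b)\<^sup>2) = (\<Sum>b\<in>R. (z b)\<^sup>2)"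
        using R by (intro sum.cong) auto
      then show "G (z(b2 := y, b1 := x)) = F \<tau> * indicator ({f. (\<Sum>b\<in>R. (f b)\<^sup>2) \<le> q - \<tau>} \<inter> space (Pi\<^sub>M R (\<lambda>_. lborel))) z"
        using b z by (simp add: G_def \<tau>_def indicator_def algebra_simps)
    qed
    also have "\<dots> = F \<tau> * emeasure (Pi\<^sub>M R (\<lambda>_. lborel)) ({f. (\<Sum>b\<in>R. (f b)\<^sup>2) \<le> q - \<tau>} \<inter> space (Pi\<^sub>M R (\<lambda>_. lborel)))"
      using R(1) by (subst nn_integral_cmult_indicator) measurable
    also have "\<dots> = H \<tau>"
    proof (cases "\<tau> \<le> q")
      case True
      then have "sqrt (q - \<tau>) ^ card R = (q - \<tau>) ^ (k - 1)"
        by (simp add: card power_mult)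
      then show ?thesis using True R(1) \<open>R \<noteq> {}\<close>
        by (simp add: emeasure_PiM_ball H_def cardV)
    next
      case False
      have "0 \<le> (\<Sum>b\<in>R. (f b)\<^sup>2)" for f :: "'a \<Rightarrow> real"
        by (simp add: sum_nonneg)
      then have "{f. (\<Sum>b\<in>R. (f b)\<^sup>2) \<le> q - \<tau>} = {}"
        using False by (fastforce dest: order_trans)
      then show ?thesis using False by (simp add: H_def)
    qed
    finally show "(\<integral>\<^sup>+z. G (z(b2 := y, b1 := x)) \<partial>Pi\<^sub>M R (\<lambda>_. lborel)) = H (x\<^sup>2 + y\<^sup>2)"
      by (simp add: \<tau>_def)
  qed
  also have "\<dots> = ennreal pi * (\<integral>\<^sup>+\<tau>. H \<tau> * indicator {0..} \<tau> \<partial>lborel)"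
    by (rule nn_integral_sum_of_squares) (simp add: H_def)
  also have "(\<integral>\<^sup>+\<tau>. H \<tau> * indicator {0..} \<tau> \<partial>lborel) =
      (\<integral>\<^sup>+\<tau>. ennreal V * (F \<tau> * ennreal ((q - \<tau>) ^ (k - 1)) * indicator {0..q} \<tau>) \<partial>lborel)"
    using V0 by (intro nn_integral_cong) (auto simp: H_def indicator_def ennreal_mult mult_ac)
  also have "\<dots> = ennreal V * (\<integral>\<^sup>+\<tau>. F \<tau> * ennreal ((q - \<tau>) ^ (k - 1)) * indicator {0..q} \<tau> \<partial>lborel)"
    by (subst nn_integral_cmult) auto
  finally show ?thesis
    using V0 by (simp add: V_def ennreal_mult mult_ac)
qed

text \<open>Rotations in the plane of \<open>b1\<close> and \<open>b2\<close> preserve the volume,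
  so it equals its average over a full turn. After exchanging the integrals, the integral over the
  angle is the arc overlap, a function of the distance in the plane alone, and the integral over the
  ball reduces to one variable.\<close>

lemma emeasure_ball_Int_halfspaces:
  fixes u1 u2 :: "real^'m::{finite,wellorder}"
  assumes dim: "CARD('m) = 2 * k" "k \<ge> 2" and unit: "norm u1 = 1" "norm u2 = 1" and u: "0 \<le> u"
  shows "emeasure lborel {x. x \<bullet> x \<le> 1 + u \<and> 1 \<le> x \<bullet> u1 \<and> 1 \<le> x \<bullet> u2} =
    ennreal (unit_ball_vol (real (2 * k - 2)) / 2) *
      (\<integral>\<^sup>+w. ennreal ((u - w) ^ (k - 1) * lens (arccos (u1 \<bullet> u2)) w) * indicator {0..u} w \<partial>lborel)"
proof -
  define \<theta> where "\<theta> = arccos (u1 \<bullet> u2)"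
  have "\<bar>u1 \<bullet> u2\<bar> \<le> 1"
    using Cauchy_Schwarz_ineq2[of u1 u2] unit by simp
  then have \<theta>: "0 \<le> \<theta>" "\<theta> \<le> pi"
    by (auto simp: \<theta>_def abs_le_iff intro!: arccos_lbound arccos_ubound)
  have "card (Basis :: (real^'m::_) set) \<ge> 2" using dim by simp
  then obtain b1 b2 :: "real^'m::_" where b: "b1 \<in> Basis" "b2 \<in> Basis" "b1 \<noteq> b2"
    by (meson card_2_iff' ex_card subset_eq)
  have nb: "norm b1 = 1" "norm b2 = 1" "b1 \<bullet> b2 = 0"
    using b by (simp_all add: inner_Basis)
  obtain T where T: "orthogonal_transformation T" "T u1 = b1" "T u2 = cos \<theta> *\<^sub>R b1 + sin \<theta> *\<^sub>R b2"
    using orthogonal_transformation_align_plane[OF unit nb] unfolding \<theta>_def by blast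
  have meas: "f \<in> borel_measurable borel" if "orthogonal_transformation f" for f :: "real^'m::_ \<Rightarrow> real^'m::_"
    by (intro borel_measurable_continuous_onI linear_continuous_on)
       (simp add: that orthogonal_transformation_linear linear_conv_bounded_linear[symmetric])
  define B where "B = {x :: real^'m::_. x \<bullet> x \<le> 1 + u}"
  define A where "A = {x \<in> B. 1 \<le> x \<bullet> b1 \<and> 1 \<le> cos \<theta> * (x \<bullet> b1) + sin \<theta> * (x \<bullet> b2)}"
  have [measurable]: "B \<in> sets borel" "A \<in> sets borel" unfolding A_def B_def by auto
  define R where "R = plane_rotation b1 b2"
  have R: "orthogonal_transformation (R \<phi>)" for \<phi>
    unfolding R_def by (rule orthogonal_transformation_plane_rotation[OF nb])
  have RA: "indicator A (R \<phi> x) = (indicator B x * indicator {\<phi>. 1 \<le> cos \<phi> * (x \<bullet> b1) - sin \<phi> * (x \<bullet> b2) \<and> 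
             1 \<le> cos \<theta> * (cos \<phi> * (x \<bullet> b1) - sin \<phi> * (x \<bullet> b2)) + sin \<theta> * (cos \<phi> * (x \<bullet> b2) + sin \<phi> * (x \<bullet> b1))} \<phi> :: ennreal)" for x \<phi>
  proof -
    have "R \<phi> x \<bullet> R \<phi> x = x \<bullet> x"
      using R by (simp add: orthogonal_transformation_def)
    then show ?thesis
      by (simp add: A_def B_def indicator_def R_def plane_rotation_inner_1[OF nb] plane_rotation_inner_2[OF nb])
  qed
  define F where "F \<tau> = ennreal (indicator {1..} \<tau> * lens \<theta> (\<tau> - 1))" for \<tau> :: real
  define I where "I = (\<integral>\<^sup>+w. ennreal ((u - w) ^ (k - 1) * lens \<theta> w) * indicator {0..u} w \<partial>lborel)"
  define V where "V = unit_ball_vol (real (2 * k - 2))"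
  have V0: "V \<ge> 0" by (simp add: V_def)

  have "{x. x \<bullet> x \<le> 1 + u \<and> 1 \<le> x \<bullet> u1 \<and> 1 \<le> x \<bullet> u2} = T -` A"
  proof -
    have "T x \<bullet> T y = x \<bullet> y" for x y
      using T(1) by (simp add: orthogonal_transformation_def)
    from this[of _ u1] this[of _ u2] this
    have "T x \<bullet> b1 = x \<bullet> u1" "cos \<theta> * (T x \<bullet> b1) + sin \<theta> * (T x \<bullet> b2) = x \<bullet> u2" "T x \<bullet> T x = x \<bullet> x" for x
      by (simp_all add: T(2,3) inner_add_right)
    then show ?thesis by (auto simp: A_def B_def)
  qed
  then have "emeasure lborel {x. x \<bullet> x \<le> 1 + u \<and> 1 \<le> x \<bullet> u1 \<and> 1 \<le> x \<bullet> u2} = emeasure (distr lborel borel T) A"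
    using meas[OF T(1)] by (subst emeasure_distr) auto
  also have "\<dots> = emeasure lborel A"
    using lborel_distr_orthogonal_transformation[OF T(1)] by simp
  finally have E: "emeasure lborel {x. x \<bullet> x \<le> 1 + u \<and> 1 \<le> x \<bullet> u1 \<and> 1 \<le> x \<bullet> u2} = emeasure lborel A" .

  have rot: "emeasure lborel A = (\<integral>\<^sup>+x. indicator A (R \<phi> x) \<partial>lborel)" for \<phi>
  proof -
    have "emeasure lborel A = (\<integral>\<^sup>+x. indicator A x \<partial>distr lborel borel (R \<phi>))"
      by (simp add: lborel_distr_orthogonal_transformation[OF R])
    also have "\<dots> = (\<integral>\<^sup>+x. indicator A (R \<phi> x) \<partial>lborel)"
      using meas[OF R] by (subst nn_integral_distr) auto
    finally show ?thesis .
  qed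
  interpret lborel_pair: pair_sigma_finite "lborel :: real measure" "lborel :: (real^'m::_) measure" ..
  have [measurable]: "(\<lambda>(\<phi>, x). R \<phi> x) \<in> borel_measurable (borel \<Otimes>\<^sub>M borel)"
    unfolding borel_prod R_def plane_rotation_def split_beta
    by (intro borel_measurable_continuous_onI continuous_intros)
  have "ennreal (2 * pi) * emeasure lborel A = (\<integral>\<^sup>+\<phi>. emeasure lborel A * indicator {-pi..<pi} \<phi> \<partial>lborel)"
    by (subst nn_integral_cmult_indicator) (auto simp: mult.commute)
  also have "\<dots> = (\<integral>\<^sup>+\<phi>. \<integral>\<^sup>+x. indicator A (R \<phi> x) * indicator {-pi..<pi} \<phi> \<partial>lborel \<partial>lborel)"
    using meas[OF R] by (intro nn_integral_cong, subst rot, subst nn_integral_multc) auto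
  also have "\<dots> = (\<integral>\<^sup>+x. \<integral>\<^sup>+\<phi>. indicator A (R \<phi> x) * indicator {-pi..<pi} \<phi> \<partial>lborel \<partial>lborel)"
    by (rule lborel_pair.Fubini'[symmetric]) measurable
  also have "\<dots> = (\<integral>\<^sup>+x. F ((x \<bullet> b1)\<^sup>2 + (x \<bullet> b2)\<^sup>2) * indicator B x \<partial>lborel)"
  proof (intro nn_integral_cong)
    fix x :: "real^'m::_"
    have "(\<integral>\<^sup>+\<phi>. indicator A (R \<phi> x) * indicator {-pi..<pi} \<phi> \<partial>lborel) =
      indicator B x * F ((x \<bullet> b1)\<^sup>2 + (x \<bullet> b2)\<^sup>2)"
      unfolding RA F_def nn_integral_arc_intersection[OF \<theta>, symmetric] mult.assoc
      by (subst nn_integral_cmult) auto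
    then show "(\<integral>\<^sup>+\<phi>. indicator A (R \<phi> x) * indicator {-pi..<pi} \<phi> \<partial>lborel) =
      F ((x \<bullet> b1)\<^sup>2 + (x \<bullet> b2)\<^sup>2) * indicator B x" by (simp add: mult.commute)
  qed
  also have "\<dots> = ennreal (V * pi) * (\<integral>\<^sup>+\<tau>. F \<tau> * ennreal ((1 + u - \<tau>) ^ (k - 1)) * indicator {0..1 + u} \<tau> \<partial>lborel)"
    unfolding B_def V_def using b dim by (intro nn_integral_ball_plane_projection) (auto simp: F_def)
  \<comment> \<open>Substitution \<open>\<tau> = 1 + w\<close>; \<open>F\<close> vanishes for \<tau>
    below 1.\<close>
  also have "(\<integral>\<^sup>+\<tau>. F \<tau> * ennreal ((1 + u - \<tau>) ^ (k - 1)) * indicator {0..1 + u} \<tau> \<partial>lborel) = I"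
    unfolding I_def
    by (subst nn_integral_real_affine[of _ 1 1])
       (auto simp: F_def indicator_def ennreal_mult' mult.commute intro!: nn_integral_cong)
  also have "ennreal (V * pi) * I = ennreal (2 * pi) * (ennreal (V / 2) * I)"
    using V0 by (simp add: ennreal_mult[symmetric] mult.assoc[symmetric] mult.commute[of pi])
  finally have "emeasure lborel A = ennreal (V / 2) * I"
    by (subst (asm) ennreal_mult_cancel_left) auto
  then show ?thesis using E by (simp add: I_def V_def \<theta>_def)
qed

lemma measure_ball_Int_halfspaces:
  fixes u1 u2 :: "real^'m::{finite,wellorder}"
  assumes dim: "CARD('m) = 2 * k" "k \<ge> 2" and unit: "norm u1 = 1" "norm u2 = 1" and u: "0 \<le> u"
  shows "measure lborel {x. x \<bullet> x \<le> 1 + u \<and> 1 \<le> x \<bullet> u1 \<and> 1 \<le> x \<bullet> u2} =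
    unit_ball_vol (real (2 * k - 2)) / 2 * integral {0..u} (\<lambda>w. (u - w) ^ (k - 1) * lens (arccos (u1 \<bullet> u2)) w)"
proof -
  let ?f = "\<lambda>w. (u - w) ^ (k - 1) * lens (arccos (u1 \<bullet> u2)) w"
  have int: "(?f has_integral integral {0..u} ?f) {0..u}"
    by (intro integrable_integral integrable_continuous_interval continuous_intros)
  then have "0 \<le> integral {0..u} ?f"
    by (rule has_integral_nonneg) auto
  have "(\<integral>\<^sup>+w. ennreal (?f w) * indicator {0..u} w \<partial>lborel) = (\<integral>\<^sup>+w. ennreal (indicator {0..u} w * ?f w) \<partial>lborel)"
    by (intro nn_integral_cong) (auto simp: indicator_def)
  also have "\<dots> = ennreal (integral {0..u} ?f)"
    by (rule nn_integral_has_integral_lebesgue[OF _ int]) auto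
  finally show ?thesis
    using emeasure_ball_Int_halfspaces[OF assms] \<open>0 \<le> integral {0..u} ?f\<close>
    by (simp add: measure_def enn2real_mult)
qed

text \<open>Up to a positive factor the form is the integral of the square of the sum of
  \<open>c i * indicator (H i)\<close> over a ball that grows with \<open>u\<close>. Monotonicity is
  stronger than nonnegativity: it permits one differentiation in \<open>u\<close>, which lowers the
  exponent \<open>k - 1\<close> by one.\<close>

lemma lens_form_mono:
  fixes x :: "nat \<Rightarrow> real^'m::{finite,wellorder}"
  assumes dim: "CARD('m) = 2 * k" "k \<ge> 2" and unit: "\<And>i. i < N \<Longrightarrow> norm (x i) = 1" and u: "0 \<le> u" "u \<le> v"
  shows "(\<Sum>i<N. \<Sum>j<N. c i * c j * integral {0..u} (\<lambda>w. (u - w) ^ (k - 1) * lens (arccos (x i \<bullet> x j)) w)) \<le>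
         (\<Sum>i<N. \<Sum>j<N. c i * c j * integral {0..v} (\<lambda>w. (v - w) ^ (k - 1) * lens (arccos (x i \<bullet> x j)) w))"
proof -
  define \<Phi> where "\<Phi> u = (\<Sum>i<N. \<Sum>j<N. c i * c j * integral {0..u} (\<lambda>w. (u - w) ^ (k - 1) * lens (arccos (x i \<bullet> x j)) w))" for u
  define V where "V = unit_ball_vol (real (2 * k - 2)) / 2"
  define H where "H i = {y. 1 \<le> y \<bullet> x i}" for i
  define B where "B u = {y :: real^'m::_. y \<bullet> y \<le> 1 + u}" for u
  have [measurable]: "B u \<in> sets borel" "H i \<in> sets borel" for u i
    unfolding B_def H_def by auto
  have Bsub: "B u \<subseteq> cball 0 (sqrt (1 + u))" for u
    by (auto simp: B_def norm_eq_sqrt_inner)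
  have fin: "emeasure lborel (B u \<inter> H i \<inter> H j) < \<infinity>" for u i j
    using Bsub[of u] by (intro emeasure_bounded_finite bounded_subset[OF bounded_cball]) auto
  have expand: "(\<Sum>i<N. c i * indicator (H i) y)\<^sup>2 * indicator (B u) y =
      (\<Sum>i<N. \<Sum>j<N. c i * c j * indicator (B u \<inter> H i \<inter> H j) y)" for u y
    unfolding power2_eq_square sum_product
    unfolding sum_distrib_right
    by (intro sum.cong refl) (simp add: indicator_inter_arith mult_ac)
  have int: "integrable lborel (\<lambda>y. (\<Sum>i<N. c i * indicator (H i) y)\<^sup>2 * indicator (B u) y)" for u
    unfolding expand using fin by (intro Bochner_Integration.integrable_sum integrable_mult_right integrable_real_indicator) auto
  have "V * \<Phi> u = (\<integral>y. (\<Sum>i<N. c i * indicator (H i) y)\<^sup>2 * indicator (B u) y \<partial>lborel)" if "0 \<le> u" for u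
  proof -
    have "B u \<inter> H i \<inter> H j = {y. y \<bullet> y \<le> 1 + u \<and> 1 \<le> y \<bullet> x i \<and> 1 \<le> y \<bullet> x j}" for i j
      by (auto simp: B_def H_def)
    then have "measure lborel (B u \<inter> H i \<inter> H j) = V * integral {0..u} (\<lambda>w. (u - w) ^ (k - 1) * lens (arccos (x i \<bullet> x j)) w)"
      if "i < N" "j < N" for i j
      using measure_ball_Int_halfspaces[OF dim unit unit \<open>0 \<le> u\<close>] that by (simp add: V_def)
    then have "V * \<Phi> u = (\<Sum>i<N. \<Sum>j<N. c i * c j * measure lborel (B u \<inter> H i \<inter> H j))"
      by (simp add: \<Phi>_def sum_distrib_left mult_ac)
    also have "\<dots> = (\<Sum>i<N. \<Sum>j<N. (\<integral>y. c i * c j * indicator (B u \<inter> H i \<inter> H j) y \<partial>lborel))"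
      by simp
    also have "\<dots> = (\<integral>y. (\<Sum>i<N. \<Sum>j<N. c i * c j * indicator (B u \<inter> H i \<inter> H j) y) \<partial>lborel)"
    proof -
      have "integrable lborel (\<lambda>y. c i * c j * indicator (B u \<inter> H i \<inter> H j) y)" for i j
        using fin by (intro integrable_mult_right integrable_real_indicator) auto
      then show ?thesis
        by (simp only: Bochner_Integration.integral_sum Bochner_Integration.integrable_sum)
    qed
    finally show ?thesis by (simp only: expand)
  qed note V\<Phi> = this
  have "(\<integral>y. (\<Sum>i<N. c i * indicator (H i) y)\<^sup>2 * indicator (B u) y \<partial>lborel) \<le> (\<integral>y. (\<Sum>i<N. c i * indicator (H i) y)\<^sup>2 * indicator (B v) y \<partial>lborel)"
    using u by (intro integral_mono int mult_left_mono) (auto simp: indicator_def B_def)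
  then have "V * \<Phi> u \<le> V * \<Phi> v" using V\<Phi> u by simp
  moreover have "V > 0" by (simp add: V_def)
  ultimately show ?thesis by (simp add: \<Phi>_def)
qed

section \<open>Repeated integration by parts against completely monotone weights\<close>

definition primitive :: "(real \<Rightarrow> real) \<Rightarrow> real \<Rightarrow> real" where
  "primitive h v = integral {0..v} h"

lemma primitive_0 [simp]: "primitive h 0 = 0"
  by (simp add: primitive_def)

lemma primitive_deriv:
  assumes "continuous_on {0..} h" "0 \<le> v"
  shows "(primitive h has_real_derivative h v) (at v within {0..})"
proof -
  have "(primitive h has_real_derivative h v) (at v within {0..v + 1})"
    unfolding primitive_def using assms
    by (intro integral_has_real_derivative) (auto intro: continuous_on_subset)
  moreover have "at v within {0..} = at v within {0..v + 1}"
    by (rule at_within_nhd[of _ "{..<v + 1}"]) auto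
  ultimately show ?thesis by simp
qed

lemma primitive_deriv_at:
  assumes "continuous_on {0..} h" "0 < v"
  shows "(primitive h has_real_derivative h v) (at v)"
proof -
  have "at v within {0..} = at v"
    using assms(2) by (intro at_within_interior) simp
  then show ?thesis using primitive_deriv[OF assms(1), of v] assms(2) by simp
qed

lemma continuous_on_primitive:
  assumes "continuous_on {0..} h"
  shows "continuous_on {0..} (primitive h)"
  using primitive_deriv[OF assms] DERIV_continuous_on by (metis atLeast_iff)

lemma continuous_on_iterated_primitive:
  "continuous_on {0..} h \<Longrightarrow> continuous_on {0..} ((primitive ^^ n) h)"
  by (induction n) (auto intro: continuous_on_primitive)

text \<open>Cauchy's formula for repeated integration. The induction hypothesis is applied to
  \<open>primitive h\<close>, followed by one integration by parts; the boundary terms vanish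
  through the power at \<open>u\<close> and the primitive at 0.\<close>

lemma iterated_primitive_eq:
  assumes "continuous_on {0..} h" "0 \<le> u"
  shows "(primitive ^^ Suc n) h u = integral {0..u} (\<lambda>w. (u - w) ^ n / fact n * h w)"
  using assms(1)
proof (induction n arbitrary: h)
  case 0
  then show ?case by (simp add: primitive_def)
next
  case (Suc n)
  let ?f = "\<lambda>w. (u - w) ^ Suc n / fact (Suc n) * primitive h w"
  have cont: "continuous_on {0..u} h" "continuous_on {0..u} (primitive h)"
    using Suc.prems continuous_on_primitive[OF Suc.prems] by (auto intro: continuous_on_subset)
  have "((\<lambda>w. (u - w) ^ Suc n / fact (Suc n) * h w - (u - w) ^ n / fact n * primitive h w) has_integral ?f u - ?f 0) {0..u}"
  proof (rule fundamental_theorem_of_calculus_interior)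
    show "continuous_on {0..u} ?f"
      by (intro continuous_intros cont) auto
    fix w assume w: "w \<in> {0<..<u}"
    have 1: "(primitive h has_real_derivative h w) (at w)"
      using w by (intro primitive_deriv_at[OF Suc.prems]) simp
    have 2: "((\<lambda>w. (u - w) ^ Suc n / fact (Suc n)) has_real_derivative - ((u - w) ^ n / fact n)) (at w)"
      by (rule DERIV_cong[OF DERIV_cdivide[OF DERIV_power_Suc[OF DERIV_diff[OF DERIV_const DERIV_ident]]]])
         (simp add: divide_simps)
    have "(?f has_real_derivative (u - w) ^ Suc n / fact (Suc n) * h w - (u - w) ^ n / fact n * primitive h w) (at w)"
      by (rule DERIV_cong[OF DERIV_mult[OF 2 1]]) simp
    then show "(?f has_vector_derivative (u - w) ^ Suc n / fact (Suc n) * h w - (u - w) ^ n / fact n * primitive h w) (at w)"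
      by (simp add: has_real_derivative_iff_has_vector_derivative)
  qed (use assms in simp)
  then have "integral {0..u} (\<lambda>w. (u - w) ^ Suc n / fact (Suc n) * h w - (u - w) ^ n / fact n * primitive h w) = 0"
    by (auto dest: integral_unique)
  moreover have "integral {0..u} (\<lambda>w. (u - w) ^ Suc n / fact (Suc n) * h w - (u - w) ^ n / fact n * primitive h w) =
    integral {0..u} (\<lambda>w. (u - w) ^ Suc n / fact (Suc n) * h w) - integral {0..u} (\<lambda>w. (u - w) ^ n / fact n * primitive h w)"
    by (intro integral_diff integrable_continuous_interval continuous_intros cont) auto
  ultimately show ?case
    using Suc.IH[OF continuous_on_primitive[OF Suc.prems]] by (simp add: funpow_swap1)
qed

text \<open>The negated derivative of a weight is a nonnegative combination of weights, with the exponent \<open>a\<close>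
  lowered by at most one; \<open>weight t (1 / 2) 1 a\<close> is what \<open>(t - s) powr a\<close> becomes under the
  substitution \<open>s = 2 * arctan (sqrt v)\<close>.\<close>

definition weight :: "real \<Rightarrow> real \<Rightarrow> real \<Rightarrow> real \<Rightarrow> real \<Rightarrow> real" where
  "weight t \<alpha> \<beta> a v = v powr (- \<alpha>) * (1 + v) powr (- \<beta>) * (t - 2 * arctan (sqrt v)) powr a"

lemma weight_nonneg [simp]: "0 \<le> weight t \<alpha> \<beta> a v"
  by (simp add: weight_def)

lemma has_real_derivative_arctan_sqrt:
  assumes "0 < v"
  shows "((\<lambda>v. 2 * arctan (sqrt v)) has_real_derivative v powr (- (1 / 2)) * (1 + v) powr (- 1)) (at v)"
proof -
  have "((\<lambda>v. 2 * arctan (sqrt v)) has_real_derivative 2 * (inverse (1 + (sqrt v)\<^sup>2) * (inverse (sqrt v) / 2))) (at v)"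
    using assms by (auto intro!: derivative_eq_intros)
  moreover have "2 * (inverse (1 + (sqrt v)\<^sup>2) * (inverse (sqrt v) / 2)) = v powr (- (1 / 2)) * (1 + v) powr (- 1)"
    using assms by (simp add: powr_minus powr_half_sqrt divide_simps)
  ultimately show ?thesis by simp
qed

text \<open>The product rule; the inner derivative of the last power, itself a product of powers of
  \<open>v\<close> and \<open>1 + v\<close>, is absorbed into \<alpha> and \<beta>. The family is
  thus closed under differentiation.\<close>

lemma has_real_derivative_weight:
  assumes "0 < v" "2 * arctan (sqrt v) < t"
  shows "(weight t \<alpha> \<beta> a has_real_derivative
     - (\<alpha> * weight t (\<alpha> + 1) \<beta> a v + \<beta> * weight t \<alpha> (\<beta> + 1) a v + a * weight t (\<alpha> + 1 / 2) (\<beta> + 1) (a - 1) v)) (at v)"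
proof -
  define s where "s v = 2 * arctan (sqrt v)" for v
  have s: "(s has_real_derivative v powr (- (1 / 2)) * (1 + v) powr (- 1)) (at v)"
    unfolding s_def by (rule has_real_derivative_arctan_sqrt[OF assms(1)])
  have "s v < t" using assms by (simp add: s_def)
  have 1: "((\<lambda>v. v powr (- \<alpha>)) has_real_derivative - \<alpha> * v powr (- \<alpha> - 1)) (at v)"
    using assms by (auto intro!: derivative_eq_intros)
  have 2: "((\<lambda>v. (1 + v) powr (- \<beta>)) has_real_derivative - \<beta> * (1 + v) powr (- \<beta> - 1)) (at v)"
    using assms by (auto intro!: derivative_eq_intros)
  have 3: "((\<lambda>v. (t - s v) powr a) has_real_derivative
      - (a * (t - s v) powr (a - 1) * (v powr (- (1 / 2)) * (1 + v) powr (- 1)))) (at v)"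
    using \<open>s v < t\<close> by (auto intro!: derivative_eq_intros s)
  have e: "v powr (- (\<alpha> + 1)) = v powr (- \<alpha> - 1)" "(1 + v) powr (- (\<beta> + 1)) = (1 + v) powr (- \<beta>) * (1 + v) powr (- 1)"
    "(1 + v) powr (- \<beta> - 1) = (1 + v) powr (- \<beta>) * (1 + v) powr (- 1)"
    "v powr (- (\<alpha> + 1 / 2)) = v powr (- \<alpha>) * v powr (- (1 / 2))"
    unfolding powr_add[symmetric] by (simp_all only: minus_add_distrib diff_conv_add_uminus)
  show ?thesis
    unfolding weight_def s_def[symmetric] e
    by (rule DERIV_cong[OF DERIV_mult[OF DERIV_mult[OF 1 2] 3]])
       (simp only: e, simp add: algebra_simps)
qed

lemma arctan_sqrt_mono: "v \<le> w \<Longrightarrow> arctan (sqrt v) \<le> arctan (sqrt w)"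
  by (simp add: arctan_monotone')

text \<open>The base of the last power vanishes at \<open>b\<close>, where continuity rests on
  \<open>0 < a\<close>; the point 0 is excluded because of the negative power of
  \<open>v\<close>.\<close>

lemma continuous_on_weight:
  assumes "S \<subseteq> {0<..b}" "2 * arctan (sqrt b) = t" "0 < a"
  shows "continuous_on S (weight t \<alpha> \<beta> a)"
  unfolding weight_def using assms arctan_sqrt_mono[of _ b]
  by (intro continuous_intros continuous_on_powr') (auto simp: subset_iff)

lemma weight_antimono:
  assumes "0 < v" "v \<le> w" "2 * arctan (sqrt w) \<le> t" "0 \<le> \<alpha>" "0 \<le> \<beta>" "0 \<le> a"
  shows "weight t \<alpha> \<beta> a w \<le> weight t \<alpha> \<beta> a v"
  unfolding weight_def using assms arctan_sqrt_mono[of v w]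
  by (intro mult_mono powr_mono2' powr_mono2) auto

text \<open>Integration by parts trades \<open>h\<close> for its primitive and the weight for its
  negated derivative, a nonnegative combination of weights. Boundary terms vanish, the weight being
  0 at \<open>B\<close> and the primitive 0 at the origin. The shift by \<epsilon> avoids the
  singularity of the weights at 0.\<close>

lemma weighted_integral_nonneg:
  fixes J :: "nat \<Rightarrow> real \<Rightarrow> real"
  assumes b: "2 * arctan (sqrt (B + \<epsilon>)) = t" and \<epsilon>: "0 < \<epsilon>" "0 \<le> B"
    and J: "\<And>v. 0 \<le> v \<Longrightarrow> 0 \<le> (primitive ^^ Suc m) h v" "continuous_on {0..} h"
    and a: "real m < a" "0 \<le> \<alpha>" "0 \<le> \<beta>"
  shows "0 \<le> integral {0..B} (\<lambda>v. weight t \<alpha> \<beta> a (v + \<epsilon>) * h v)"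
  using J a
proof (induction m arbitrary: h \<alpha> \<beta> a)
  case 0
  have wB: "weight t \<alpha> \<beta> a (B + \<epsilon>) = 0"
    using b by (simp add: weight_def)
  have "h integrable_on {0..B}"
    using "0.prems" by (intro integrable_continuous_interval) (auto intro: continuous_on_subset)
  \<comment> \<open>The exponent may be below 1 now, so the weight is not differentiated again; the
    second mean value theorem uses only its monotonicity. Negation makes it increasing, and since it
    is 0 at \<open>B\<close> only the integral up to \<open>c\<close> survives.\<close>
  then obtain c where c: "c \<in> {0..B}"
    "integral {0..B} (\<lambda>v. - weight t \<alpha> \<beta> a (v + \<epsilon>) * h v) =
      - weight t \<alpha> \<beta> a (0 + \<epsilon>) * integral {0..c} h + - weight t \<alpha> \<beta> a (B + \<epsilon>) * integral {c..B} h"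
  proof (rule second_mean_value_theorem[where g = "\<lambda>v. - weight t \<alpha> \<beta> a (v + \<epsilon>)"])
    show "- weight t \<alpha> \<beta> a (x + \<epsilon>) \<le> - weight t \<alpha> \<beta> a (y + \<epsilon>)" if "0 \<le> x" "x \<le> y" "y \<le> B" for x y
      using that \<epsilon> b "0.prems" arctan_sqrt_mono[of "y + \<epsilon>" "B + \<epsilon>"]
      by (intro le_imp_neg_le weight_antimono) auto
  qed (use \<epsilon> in auto)
  have "0 \<le> integral {0..c} h"
    using "0.prems"(1)[of c] c by (simp add: primitive_def)
  then show ?case using c wB by simp
next
  case (Suc m)
  let ?W = "\<lambda>\<alpha> \<beta> a v. weight t \<alpha> \<beta> a (v + \<epsilon>)"
  let ?H = "primitive h"
  have cH: "continuous_on {0..} ?H" by (rule continuous_on_primitive[OF Suc.prems(2)])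
  have cont: "continuous_on {0..B} h" "continuous_on {0..B} ?H"
    using Suc.prems(2) cH by (auto intro: continuous_on_subset)
  have cW: "continuous_on {0..B} (?W \<alpha> \<beta> a)" if "0 < a" for \<alpha> \<beta> a
    using \<epsilon> by (intro continuous_on_weight[OF _ b that] continuous_on_compose2[of "{\<epsilon>..B + \<epsilon>}" "weight t \<alpha> \<beta> a" _ "\<lambda>v. v + \<epsilon>"] continuous_intros) auto
  have alg: "- (\<alpha> * p + \<beta> * q + a * r) * y + z * w = w * z - (\<alpha> * (p * y) + \<beta> * (q * y) + a * (r * y))"
    for p q r w y z by (simp add: algebra_simps)
  have "((\<lambda>v. ?W \<alpha> \<beta> a v * h v - (\<alpha> * (?W (\<alpha> + 1) \<beta> a v * ?H v) + \<beta> * (?W \<alpha> (\<beta> + 1) a v * ?H v) +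
       a * (?W (\<alpha> + 1 / 2) (\<beta> + 1) (a - 1) v * ?H v))) has_integral
       ?W \<alpha> \<beta> a B * ?H B - ?W \<alpha> \<beta> a 0 * ?H 0) {0..B}"
  proof (rule fundamental_theorem_of_calculus_interior)
    show "continuous_on {0..B} (\<lambda>v. ?W \<alpha> \<beta> a v * ?H v)"
      using Suc.prems by (intro continuous_intros cW cont) auto
    fix v assume v: "v \<in> {0<..<B}"
    have "arctan (sqrt (v + \<epsilon>)) < arctan (sqrt (B + \<epsilon>))" using v by (simp add: arctan_less_iff)
    then have "(weight t \<alpha> \<beta> a has_real_derivative
      - (\<alpha> * ?W (\<alpha> + 1) \<beta> a v + \<beta> * ?W \<alpha> (\<beta> + 1) a v + a * ?W (\<alpha> + 1 / 2) (\<beta> + 1) (a - 1) v)) (at (v + \<epsilon>))"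
      using v \<epsilon> b by (intro has_real_derivative_weight) auto
    then have dW: "(?W \<alpha> \<beta> a has_real_derivative
      - (\<alpha> * ?W (\<alpha> + 1) \<beta> a v + \<beta> * ?W \<alpha> (\<beta> + 1) a v + a * ?W (\<alpha> + 1 / 2) (\<beta> + 1) (a - 1) v)) (at v)"
      by (simp add: DERIV_shift)
    have dH: "(?H has_real_derivative h v) (at v)"
      using v by (intro primitive_deriv_at[OF Suc.prems(2)]) simp
    have "((\<lambda>v. ?W \<alpha> \<beta> a v * ?H v) has_real_derivative
      ?W \<alpha> \<beta> a v * h v - (\<alpha> * (?W (\<alpha> + 1) \<beta> a v * ?H v) + \<beta> * (?W \<alpha> (\<beta> + 1) a v * ?H v) +
       a * (?W (\<alpha> + 1 / 2) (\<beta> + 1) (a - 1) v * ?H v))) (at v)"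
      by (rule DERIV_cong[OF DERIV_mult[OF dW dH] alg])
    then show "((\<lambda>v. ?W \<alpha> \<beta> a v * ?H v) has_vector_derivative
      ?W \<alpha> \<beta> a v * h v - (\<alpha> * (?W (\<alpha> + 1) \<beta> a v * ?H v) + \<beta> * (?W \<alpha> (\<beta> + 1) a v * ?H v) +
       a * (?W (\<alpha> + 1 / 2) (\<beta> + 1) (a - 1) v * ?H v))) (at v)"
      by (simp add: has_real_derivative_iff_has_vector_derivative)
  qed (use \<epsilon> in simp)
  moreover have "?W \<alpha> \<beta> a B = 0"
    using b by (simp add: weight_def)
  ultimately have "integral {0..B} (\<lambda>v. ?W \<alpha> \<beta> a v * h v - (\<alpha> * (?W (\<alpha> + 1) \<beta> a v * ?H v) + \<beta> * (?W \<alpha> (\<beta> + 1) a v * ?H v) +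
       a * (?W (\<alpha> + 1 / 2) (\<beta> + 1) (a - 1) v * ?H v))) = 0"
    by (auto dest: integral_unique)
  moreover have "integral {0..B} (\<lambda>v. ?W \<alpha> \<beta> a v * h v - (\<alpha> * (?W (\<alpha> + 1) \<beta> a v * ?H v) + \<beta> * (?W \<alpha> (\<beta> + 1) a v * ?H v) +
       a * (?W (\<alpha> + 1 / 2) (\<beta> + 1) (a - 1) v * ?H v))) = integral {0..B} (\<lambda>v. ?W \<alpha> \<beta> a v * h v) -
     (\<alpha> * integral {0..B} (\<lambda>v. ?W (\<alpha> + 1) \<beta> a v * ?H v) + \<beta> * integral {0..B} (\<lambda>v. ?W \<alpha> (\<beta> + 1) a v * ?H v) +
       a * integral {0..B} (\<lambda>v. ?W (\<alpha> + 1 / 2) (\<beta> + 1) (a - 1) v * ?H v))"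
  proof -
    have int: "(\<lambda>v. ?W \<alpha>' \<beta>' a' v * f v) integrable_on {0..B}"
      if "0 < a'" "continuous_on {0..B} f" for \<alpha>' \<beta>' a' f
      using that by (intro integrable_continuous_interval continuous_intros cW)
    have "a > 0" "a - 1 > 0" using Suc.prems by auto
    note ints = int[OF \<open>a > 0\<close> cont(1)] int[OF \<open>a > 0\<close> cont(2)] int[OF \<open>a - 1 > 0\<close> cont(2)]
    show ?thesis
      by (subst integral_diff, intro ints, intro integrable_add integrable_on_mult_right ints,
          subst integral_add, intro integrable_add integrable_on_mult_right ints, intro integrable_on_mult_right ints,
          subst integral_add, intro integrable_on_mult_right ints, intro integrable_on_mult_right ints)
        simp
  qed
  \<comment> \<open>The new exponents are \<open>a\<close>, \<open>a\<close> and
    \<open>a - 1\<close>, all above \<open>m\<close>, so the induction hypothesis for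
    \<open>primitive h\<close> covers each of the three integrals.\<close>
  moreover have "0 \<le> integral {0..B} (\<lambda>v. ?W \<alpha>' \<beta>' a' v * ?H v)" if "real m < a'" "0 \<le> \<alpha>'" "0 \<le> \<beta>'" for \<alpha>' \<beta>' a'
    using Suc.prems(1) that by (intro Suc.IH cH) (simp_all add: funpow_swap1)
  ultimately show ?case
    using Suc.prems by simp
qed

section \<open>Recovering the truncated power from lens functions\<close>

lemma lens_eq_0: "w \<le> 0 \<Longrightarrow> 0 \<le> \<theta> \<Longrightarrow> lens \<theta> w = 0"
proof -
  assume "w \<le> 0" "0 \<le> \<theta>"
  \<comment> \<open>\<open>sqrt\<close> is an odd function on the reals, hence nonpositive
    here.\<close>
  then have "arctan (sqrt w) \<le> 0" by simp
  then show ?thesis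
    unfolding lens_def using \<open>0 \<le> \<theta>\<close> by (intro max_absorb1) linarith
qed

text \<open>Under \<open>s = 2 * arctan (sqrt v)\<close> the factors with exponents
  \<open>1 / 2\<close> and 1 become the differential of \<open>s\<close>. The integral is then that
  of \<open>(t - s) powr a * (s - \<theta>)\<close> over \<open>s\<close> from \<theta> to
  \<open>t\<close>.\<close>

lemma has_integral_weight_lens:
  assumes b: "2 * arctan (sqrt b) = t" "0 < b" and \<theta>: "0 \<le> \<theta>" and a: "0 < a"
  shows "((\<lambda>v. weight t (1 / 2) 1 a v * lens \<theta> v) has_integral max 0 (t - \<theta>) powr (a + 2) / ((a + 1) * (a + 2))) {0..b}"
proof (cases "\<theta> < t")
  case False
  have "lens \<theta> v = 0" if "v \<in> {0..b}" for v
    using that False b arctan_sqrt_mono[of v b] by (simp add: lens_def)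
  then show ?thesis
    using False by (auto intro!: has_integral_is_0)
next
  case True
  define s where "s v = 2 * arctan (sqrt v)" for v
  \<comment> \<open>Chosen so that \<open>s w = \<theta>\<close>; up to this point the lens function
    is 0.\<close>
  define w where "w = (tan (\<theta> / 2))\<^sup>2"
  have "t < pi" using b(1) arctan_ubound[of "sqrt b"] by simp
  then have "0 \<le> tan (\<theta> / 2)" using \<theta> True by (intro tan_pos_pi2_le) auto
  then have sw: "s w = \<theta>"
    using \<theta> True \<open>t < pi\<close> by (simp add: s_def w_def arctan_tan)
  have w: "0 \<le> w" "w \<le> b"
  proof -
    show "w \<le> b"
      using sw True b arctan_sqrt_mono[of b w] by (intro leI notI) (simp add: s_def)
  qed (simp add: w_def)
  have mono: "s v \<le> s v'" if "v \<le> v'" for v v' using arctan_sqrt_mono[OF that] by (simp add: s_def)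
  have smono: "s v < s v'" if "v < v'" for v v' using that by (simp add: s_def arctan_less_iff)
  have sb: "s b = t" using b by (simp add: s_def)
  \<comment> \<open>The antiderivative in the variable \<open>s\<close>, found by one integration by
    parts, then composed with \<open>s\<close>. It vanishes at \<open>b\<close>.\<close>
  define G where "G v = - ((t - s v) powr (a + 1) * (s v - \<theta>) / (a + 1) + (t - s v) powr (a + 2) / ((a + 1) * (a + 2)))" for v
  have cs: "continuous_on {w..b} s" unfolding s_def by (intro continuous_intros)
  have "((\<lambda>v. weight t (1 / 2) 1 a v * lens \<theta> v) has_integral G b - G w) {w..b}"
  proof (rule fundamental_theorem_of_calculus_interior)
    show "continuous_on {w..b} G"
      unfolding G_def using a mono[of _ b] sb
      by (intro continuous_intros continuous_on_powr' cs) auto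
    fix v assume v: "v \<in> {w<..<b}"
    have sv: "\<theta> < s v" "s v < t" using smono[of w v] smono[of v b] v sw sb by auto
    have v0: "0 < v" using v w by auto
    define p where "p = v powr (- (1 / 2)) * (1 + v) powr (- 1)"
    have ds: "(s has_real_derivative p) (at v)"
      unfolding s_def p_def by (rule has_real_derivative_arctan_sqrt[OF v0])
    have d1: "((\<lambda>v. (t - s v) powr c) has_real_derivative - (c * (t - s v) powr (c - 1) * p)) (at v)" for c
      using sv by (auto intro!: derivative_eq_intros ds)
    have powr1: "(t - s v) powr (a + 1) = (t - s v) powr a * (t - s v)"
      using sv by (simp add: powr_add)
    have "(G has_real_derivative (t - s v) powr a * p * (s v - \<theta>)) (at v)"
      unfolding G_def
    proof (rule DERIV_cong[OF DERIV_minus[OF DERIV_add[OF DERIV_cdivide[OF DERIV_mult[OF d1 DERIV_diff[OF ds DERIV_const]]]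
          DERIV_cdivide[OF d1]]]])
      have "a + 1 \<noteq> 0" "a + 2 \<noteq> 0" using a by auto
      moreover have "a + 1 - 1 = a" "a + 2 - 1 = a + 1" by simp_all
      ultimately show "- ((- ((a + 1) * (t - s v) powr (a + 1 - 1) * p) * (s v - \<theta>) + (p - 0) * (t - s v) powr (a + 1)) / (a + 1) +
         - ((a + 2) * (t - s v) powr (a + 2 - 1) * p) / ((a + 1) * (a + 2))) = (t - s v) powr a * p * (s v - \<theta>)"
        by (simp add: divide_simps) (simp add: algebra_simps)
    qed
    moreover have "(t - s v) powr a * p * (s v - \<theta>) = weight t (1 / 2) 1 a v * lens \<theta> v"
      using sv by (simp add: weight_def lens_def p_def s_def[symmetric] mult_ac)
    ultimately show "(G has_vector_derivative weight t (1 / 2) 1 a v * lens \<theta> v) (at v)"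
      by (simp add: has_real_derivative_iff_has_vector_derivative)
  qed (use w in simp)
  moreover have "G b - G w = max 0 (t - \<theta>) powr (a + 2) / ((a + 1) * (a + 2))"
    using True a by (simp add: G_def sb sw)
  moreover have "((\<lambda>v. weight t (1 / 2) 1 a v * lens \<theta> v) has_integral 0) {0..w}"
  proof (rule has_integral_is_0)
    show "weight t (1 / 2) 1 a v * lens \<theta> v = 0" if "v \<in> {0..w}" for v
      using that mono[of v w] sw by (simp add: lens_def s_def)
  qed
  ultimately show ?thesis
    using has_integral_combine[OF w, of "\<lambda>v. weight t (1 / 2) 1 a v * lens \<theta> v" 0] by simp
qed

text \<open>Moving the shift from the weight to the lens gives an interval and a weight independent
  of \<epsilon>, ready for dominated convergence. The added interval from 0 to \<epsilon>
  contributes nothing, the lens being 0 at negative arguments.\<close>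

lemma weight_lens_shift:
  assumes b: "2 * arctan (sqrt b) = t" and \<epsilon>: "0 < \<epsilon>" "\<epsilon> \<le> b" and "0 \<le> \<theta>" "0 < a"
  shows "(\<lambda>v. weight t \<alpha> \<beta> a v * lens \<theta> (v - \<epsilon>)) integrable_on {0..b}"
    and "integral {0..b} (\<lambda>v. weight t \<alpha> \<beta> a v * lens \<theta> (v - \<epsilon>)) =
         integral {0..b - \<epsilon>} (\<lambda>v. weight t \<alpha> \<beta> a (v + \<epsilon>) * lens \<theta> v)"
proof -
  let ?f = "\<lambda>v. weight t \<alpha> \<beta> a v * lens \<theta> (v - \<epsilon>)"
  have "?f integrable_on {\<epsilon>..b}"
    using assms by (intro integrable_continuous_interval continuous_intros continuous_on_weight[OF _ b]) auto
  then have I: "(?f has_integral integral {\<epsilon>..b} ?f) {\<epsilon>..b}" by (rule integrable_integral)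
  moreover have "(?f has_integral 0) {0..\<epsilon>}"
    using assms by (intro has_integral_is_0) (simp add: lens_eq_0)
  ultimately have "(?f has_integral (0 + integral {\<epsilon>..b} ?f)) {0..b}"
    using assms by (intro has_integral_combine[of 0 \<epsilon> b]) auto
  then show "?f integrable_on {0..b}" and *: "integral {0..b} ?f = integral {0..b - \<epsilon>} (\<lambda>v. weight t \<alpha> \<beta> a (v + \<epsilon>) * lens \<theta> v)"
    using integral_shift_Icc_real[of 0 "b - \<epsilon>" ?f \<epsilon>] by (auto simp: o_def add.commute dest: integral_unique)
qed

lemma tendsto_weight_lens:
  assumes b: "2 * arctan (sqrt b) = t" "0 < b" and \<theta>: "0 \<le> \<theta>" and a: "0 < a"
    and \<epsilon>: "\<And>n. 0 < \<epsilon> n" "\<And>n. \<epsilon> n \<le> b" "\<epsilon> \<longlonglongrightarrow> 0"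
  shows "(\<lambda>n. integral {0..b - \<epsilon> n} (\<lambda>v. weight t (1 / 2) 1 a (v + \<epsilon> n) * lens \<theta> v))
     \<longlonglongrightarrow> max 0 (t - \<theta>) powr (a + 2) / ((a + 1) * (a + 2))"
proof -
  have t: "0 < t" using b by auto
  have "(\<lambda>n. integral {0..b} (\<lambda>v. weight t (1 / 2) 1 a v * lens \<theta> (v - \<epsilon> n)))
     \<longlonglongrightarrow> integral {0..b} (\<lambda>v. weight t (1 / 2) 1 a v * lens \<theta> v)"
  proof (rule dominated_convergence(2))
    show "(\<lambda>v. weight t (1 / 2) 1 a v * lens \<theta> (v - \<epsilon> n)) integrable_on {0..b}" for n
      using weight_lens_shift(1)[OF b(1) \<epsilon>(1,2) \<theta> a] .
    show "(\<lambda>v. 2 * t powr a) integrable_on {0..b}" by (intro integrable_continuous_interval continuous_on_const)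
    fix n v assume v: "v \<in> {0..b}"
    show "norm (weight t (1 / 2) 1 a v * lens \<theta> (v - \<epsilon> n)) \<le> 2 * t powr a"
    \<comment> \<open>At 0 the weight is 0 by the convention \<open>0 powr x = 0\<close>.\<close>
    proof (cases "v = 0")
      case False
      then have v: "0 < v" "v \<le> b" using v by auto
      \<comment> \<open>This bound cancels the singularity \<open>1 / sqrt v\<close> of the weight
        and yields a constant dominating function.\<close>
      have "lens \<theta> (v - \<epsilon> n) \<le> 2 * sqrt v"
      proof -
        have "arctan (sqrt (v - \<epsilon> n)) \<le> arctan (sqrt v)"
          using \<epsilon>(1)[of n] by (intro arctan_sqrt_mono) simp
        also have "\<dots> \<le> sqrt v" using abs_arctan_le[of "sqrt v"] v by simp
        finally have "2 * arctan (sqrt (v - \<epsilon> n)) - \<theta> \<le> 2 * sqrt v"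
          using \<theta> by linarith
        then show ?thesis
          unfolding lens_def using v by (intro max.boundedI) (assumption | simp)+
      qed
      moreover have "weight t (1 / 2) 1 a v \<le> (1 / sqrt v) * 1 * t powr a"
        unfolding weight_def
      proof (intro mult_mono)
        have "v powr - (1 / 2) = 1 / sqrt v"
          unfolding powr_minus using v(1) by (simp add: powr_half_sqrt inverse_eq_divide)
        then show "v powr - (1 / 2) \<le> 1 / sqrt v" by simp
        show "(1 + v) powr - 1 \<le> 1" using v by (simp add: powr_minus divide_simps)
        show "(t - 2 * arctan (sqrt v)) powr a \<le> t powr a"
          using v b a arctan_sqrt_mono[of v b] by (intro powr_mono2) auto
      qed (use v in auto)
      ultimately have "weight t (1 / 2) 1 a v * lens \<theta> (v - \<epsilon> n) \<le> (1 / sqrt v) * 1 * t powr a * (2 * sqrt v)"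
        using v by (intro mult_mono) auto
      then show ?thesis using v by simp
    qed (simp add: weight_def)
  next
    fix v assume "v \<in> {0..b}"
    have "isCont (lens \<theta>) v"
      using continuous_on_lens[OF continuous_on_id, of UNIV \<theta>] by (simp add: continuous_on_eq_continuous_at)
    moreover have "(\<lambda>n. v - \<epsilon> n) \<longlonglongrightarrow> v"
      using tendsto_diff[OF tendsto_const[of v] \<epsilon>(3)] by simp
    ultimately have "(\<lambda>n. lens \<theta> (v - \<epsilon> n)) \<longlonglongrightarrow> lens \<theta> v"
      by (rule isCont_tendsto_compose)
    then show "(\<lambda>n. weight t (1 / 2) 1 a v * lens \<theta> (v - \<epsilon> n)) \<longlonglongrightarrow> weight t (1 / 2) 1 a v * lens \<theta> v"
      by (rule tendsto_mult_left)
  qed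
  then show ?thesis
    using weight_lens_shift(2)[OF b(1) \<epsilon>(1,2) \<theta> a] has_integral_weight_lens[OF b \<theta> a]
    by (simp add: integral_unique)
qed

section \<open>Nonnegativity in even dimensions\<close>

text \<open>Strictness of both bounds matters: \<open>t < pi\<close> provides a finite endpoint
  \<open>b\<close>, and \<open>k < \<delta>\<close> puts the exponent \<open>a\<close> above
  \<open>k - 2\<close>, so that it stays positive through \<open>k - 2\<close> integrations by
  parts.\<close>

lemma truncated_form_nonneg_interior:
  fixes x :: "nat \<Rightarrow> real^'m::{finite,wellorder}"
  assumes dim: "CARD('m) = 2 * k" "k \<ge> 2" and unit: "\<And>i. i < N \<Longrightarrow> norm (x i) = 1"
    and t: "0 < t" "t < pi" and \<delta>: "real k < \<delta>"
  shows "0 \<le> (\<Sum>i<N. \<Sum>j<N. c i * c j * max 0 (t - arccos (x i \<bullet> x j)) powr \<delta>)"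
proof -
  define \<theta> where "\<theta> i j = arccos (x i \<bullet> x j)" for i j
  have \<theta>: "0 \<le> \<theta> i j" if "i < N" "j < N" for i j
  proof -
    have "\<bar>x i \<bullet> x j\<bar> \<le> 1"
      using Cauchy_Schwarz_ineq2[of "x i" "x j"] unit that by simp
    then show ?thesis unfolding \<theta>_def by (intro arccos_lbound) auto
  qed
  define a where "a = \<delta> - 2"
  have a: "0 < a" "real (k - 2) < a" "a + 2 = \<delta>" using \<delta> dim by (auto simp: a_def)
  define b where "b = (tan (t / 2))\<^sup>2"
  have "0 < tan (t / 2)" using t by (intro tan_gt_zero) auto
  then have b: "2 * arctan (sqrt b) = t" "0 < b"
    using t by (simp_all add: b_def arctan_tan)
  define h where "h v = (\<Sum>i<N. \<Sum>j<N. c i * c j * lens (\<theta> i j) v)" for v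
  have ch: "continuous_on S h" for S
    unfolding h_def by (intro continuous_intros)
  \<comment> \<open>By Cauchy's formula the \<open>k\<close>-fold primitive of \<open>h\<close> is,
    up to a factorial, the form already known to increase with \<open>u\<close>.\<close>
  have prim: "(primitive ^^ k) h u = (1 / fact (k - 1)) *
      (\<Sum>i<N. \<Sum>j<N. c i * c j * integral {0..u} (\<lambda>w. (u - w) ^ (k - 1) * lens (\<theta> i j) w))" if "0 \<le> u" for u
  proof -
    have "(primitive ^^ k) h u = integral {0..u} (\<lambda>w. (u - w) ^ (k - 1) / fact (k - 1) * h w)"
      using iterated_primitive_eq[OF ch that, of "k - 1"] dim by simp
    also have "\<dots> = integral {0..u} (\<lambda>w. \<Sum>i<N. \<Sum>j<N. (1 / fact (k - 1) * c i * c j) * ((u - w) ^ (k - 1) * lens (\<theta> i j) w))"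
      by (simp add: h_def sum_distrib_left mult_ac)
    also have "\<dots> = (\<Sum>i<N. \<Sum>j<N. (1 / fact (k - 1) * c i * c j) * integral {0..u} (\<lambda>w. (u - w) ^ (k - 1) * lens (\<theta> i j) w))"
      by (subst integral_sum, simp, intro integrable_continuous_interval continuous_intros, intro sum.cong refl,
          subst integral_sum, simp, intro integrable_continuous_interval continuous_intros, simp)
    finally show ?thesis by (simp add: sum_distrib_left mult_ac)
  qed
  have mono: "(primitive ^^ k) h u \<le> (primitive ^^ k) h v" if "0 \<le> u" "u \<le> v" for u v
    using that lens_form_mono[OF dim unit that, where c = c] unfolding \<theta>_def[symmetric]
    by (simp add: prim divide_right_mono)
  have pk: "(primitive ^^ k) h = primitive ((primitive ^^ (k - 1)) h)"
    using dim by (cases k) simp_all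
  \<comment> \<open>For positive \<open>v\<close> this is the derivative of an increasing function;
    at 0 the value is 0 since \<open>k - 1\<close> is at least 1.\<close>
  have nonneg: "0 \<le> (primitive ^^ (k - 1)) h v" if "0 \<le> v" for v
  proof (cases "v = 0")
    case True
    then show ?thesis using dim by (cases "k - 1") auto
  next
    case False
    then have v: "0 < v" using that by simp
    have "((primitive ^^ k) h has_real_derivative (primitive ^^ (k - 1)) h v) (at v)"
      unfolding pk by (rule primitive_deriv_at[OF continuous_on_iterated_primitive[OF ch] v])
    moreover have "mono_on {0<..} ((primitive ^^ k) h)"
      using mono by (intro mono_onI) auto
    moreover have "v \<in> interior {0<..}" using v by (simp add: interior_open)
    ultimately show ?thesis using mono_on_imp_deriv_nonneg by blast
  qed
  define \<epsilon> where "\<epsilon> n = b / real (Suc n)" for n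
  have \<epsilon>: "0 < \<epsilon> n" "\<epsilon> n \<le> b" for n
    using b by (auto simp: \<epsilon>_def field_simps)
  have \<epsilon>lim: "\<epsilon> \<longlonglongrightarrow> 0"
    unfolding \<epsilon>_def using tendsto_mult[OF tendsto_const[of b] LIMSEQ_inverse_real_of_nat] by (simp add: divide_inverse)
  define W where "W n i j = integral {0..b - \<epsilon> n} (\<lambda>v. weight t (1 / 2) 1 a (v + \<epsilon> n) * lens (\<theta> i j) v)" for n i j
  have cw: "continuous_on {0..b - \<epsilon> n} (\<lambda>v. weight t (1 / 2) 1 a (v + \<epsilon> n))" for n
    using \<epsilon>[of n] by (intro continuous_on_compose2[OF continuous_on_weight[OF _ b(1) a(1)], of "{\<epsilon> n..b}"] continuous_intros) auto
  have "0 \<le> (\<Sum>i<N. \<Sum>j<N. c i * c j * W n i j)" for n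
  proof -
    have "0 \<le> integral {0..b - \<epsilon> n} (\<lambda>v. weight t (1 / 2) 1 a (v + \<epsilon> n) * h v)"
    proof (rule weighted_integral_nonneg[where m = "k - 2"])
      show "0 \<le> (primitive ^^ Suc (k - 2)) h v" if "0 \<le> v" for v
        using nonneg[OF that] dim by (simp add: Suc_diff_le flip: numeral_2_eq_2 Suc_diff_Suc)
    qed (use \<epsilon>[of n] b a ch in auto)
    also have "\<dots> = integral {0..b - \<epsilon> n} (\<lambda>v. \<Sum>i<N. \<Sum>j<N. c i * c j * (weight t (1 / 2) 1 a (v + \<epsilon> n) * lens (\<theta> i j) v))"
      by (simp add: h_def sum_distrib_left mult_ac)
    also have "\<dots> = (\<Sum>i<N. \<Sum>j<N. c i * c j * W n i j)"
      unfolding W_def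
      by (subst integral_sum, simp, intro integrable_continuous_interval continuous_intros cw, intro sum.cong refl,
          subst integral_sum, simp, intro integrable_continuous_interval continuous_intros cw, simp)
    finally show ?thesis .
  qed
  moreover have "(\<lambda>n. \<Sum>i<N. \<Sum>j<N. c i * c j * W n i j) \<longlonglongrightarrow>
    (\<Sum>i<N. \<Sum>j<N. c i * c j * (max 0 (t - \<theta> i j) powr (a + 2) / ((a + 1) * (a + 2))))"
    unfolding W_def by (intro tendsto_sum tendsto_mult tendsto_const tendsto_weight_lens b a \<epsilon> \<epsilon>lim \<theta>) auto
  ultimately have "0 \<le> (\<Sum>i<N. \<Sum>j<N. c i * c j * (max 0 (t - \<theta> i j) powr (a + 2) / ((a + 1) * (a + 2))))"
    by (intro LIMSEQ_le_const) auto
  also have "\<dots> = (\<Sum>i<N. \<Sum>j<N. c i * c j * max 0 (t - \<theta> i j) powr \<delta>) / ((a + 1) * (a + 2))"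
    by (simp add: sum_divide_distrib a)
  finally have "0 \<le> \<dots>" .
  moreover have "0 < (a + 1) * (a + 2)" using a by simp
  ultimately show ?thesis
    unfolding \<theta>_def by (simp only: pos_le_divide_eq mult_zero_left)
qed

text \<open>The limiting cases \<open>t = pi\<close> and \<open>\<delta> = k\<close> follow by
  continuity, with \<open>t\<close> approached from below and \<delta> from above.\<close>

lemma truncated_form_nonneg_even:
  fixes x :: "nat \<Rightarrow> real^'m::{finite,wellorder}"
  assumes dim: "CARD('m) = 2 * k" "k \<ge> 2" and unit: "\<And>i. i < N \<Longrightarrow> norm (x i) = 1"
    and t: "0 < t" "t \<le> pi" and \<delta>: "real k \<le> \<delta>"
  shows "0 \<le> (\<Sum>i<N. \<Sum>j<N. c i * c j * max 0 (t - arccos (x i \<bullet> x j)) powr \<delta>)"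
proof -
  \<comment> \<open>The subtracted fraction starts at \<open>1 / 2\<close>, so that already
    \<open>T 0\<close> is positive.\<close>
  define T where "T n = t * (1 - inverse (real (Suc (Suc n))))" for n
  define D where "D n = \<delta> + inverse (real (Suc n))" for n
  have "(\<lambda>n. inverse (real (Suc (Suc n)))) \<longlonglongrightarrow> 0"
    using LIMSEQ_Suc[OF LIMSEQ_inverse_real_of_nat] .
  then have T: "T \<longlonglongrightarrow> t * (1 - 0)"
    unfolding T_def by (intro tendsto_intros)
  have D: "D \<longlonglongrightarrow> \<delta> + 0"
    unfolding D_def by (intro tendsto_intros LIMSEQ_inverse_real_of_nat)
  have "0 \<le> (\<Sum>i<N. \<Sum>j<N. c i * c j * max 0 (T n - arccos (x i \<bullet> x j)) powr D n)" for n
  proof (rule truncated_form_nonneg_interior[OF dim unit])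
    have i: "0 < inverse (real (Suc (Suc n)))" "inverse (real (Suc (Suc n))) < 1"
      by (auto simp: field_simps)
    then show "0 < T n" using t by (simp add: T_def)
    have "T n < t * 1" unfolding T_def using t i by (intro mult_strict_left_mono) auto
    then show "T n < pi" using t by simp
    have "0 < inverse (real (Suc n))" by simp
    then show "real k < D n" using \<delta> unfolding D_def by linarith
  qed
  moreover have "(\<lambda>n. \<Sum>i<N. \<Sum>j<N. c i * c j * max 0 (T n - arccos (x i \<bullet> x j)) powr D n)
    \<longlonglongrightarrow> (\<Sum>i<N. \<Sum>j<N. c i * c j * max 0 (t * (1 - 0) - arccos (x i \<bullet> x j)) powr (\<delta> + 0))"
  proof (intro tendsto_sum tendsto_mult tendsto_const tendsto_powr' tendsto_max tendsto_diff T D disjI2 conjI)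
    show "0 < \<delta> + 0" using \<delta> dim by simp
  qed auto
  ultimately show ?thesis
    by (auto intro: LIMSEQ_le_const)
qed

section \<open>Strict positivity\<close>

definition sphere_kernel :: "real \<Rightarrow> real \<Rightarrow> 'a::real_inner \<Rightarrow> 'a \<Rightarrow> real" where
  "sphere_kernel t \<delta> x y = max 0 (t - arccos (x \<bullet> y)) powr \<delta>"

lemma sphere_kernel_commute: "sphere_kernel t \<delta> x y = sphere_kernel t \<delta> y x"
  by (simp add: sphere_kernel_def inner_commute)

text \<open>The difference quotient is at most \<open>\<bar>h\<bar>\<close>. This handles the two
  places where the chain rule fails: distance \<open>t\<close>, and antipodal points.\<close>

lemma has_real_derivative_0_quadratic_bound:
  fixes f :: "real \<Rightarrow> real"
  assumes "\<And>h. \<bar>h\<bar> \<le> 1 \<Longrightarrow> \<bar>f (x + h) - f x\<bar> \<le> h\<^sup>2"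
  shows "(f has_real_derivative 0) (at x)"
  unfolding DERIV_def
proof (rule Lim_null_comparison[where g = "\<lambda>h. \<bar>h\<bar>"])
  have "\<forall>\<^sub>F h in at 0. \<bar>h\<bar> < (1::real)"
    by (rule eventually_at_ball'[of 1 0 UNIV, simplified, THEN eventually_mono]) (auto simp: dist_norm)
  then show "\<forall>\<^sub>F h in at 0. norm ((f (x + h) - f x) / h) \<le> \<bar>h\<bar>"
  proof eventually_elim
    case (elim h)
    then show ?case
      using assms[of h] by (cases "h = 0") (auto simp: divide_simps power2_eq_square abs_mult_self_eq)
  qed
  show "((\<lambda>h. \<bar>h\<bar>) \<longlongrightarrow> 0) (at (0::real))"
    by (auto intro!: tendsto_eq_intros)
qed

lemma powr_le_square:
  fixes y \<delta> :: real
  assumes "2 \<le> \<delta>" "0 \<le> y" "y \<le> 1"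
  shows "y powr \<delta> \<le> y\<^sup>2"
  using powr_mono'[OF assms] assms(2) by simp

lemma truncated_power_differentiable:
  fixes t \<delta> y :: real
  assumes "2 \<le> \<delta>"
  shows "\<exists>D. ((\<lambda>y. max 0 (t - y) powr \<delta>) has_real_derivative D) (at y)"
proof -
  consider "y < t" | "y > t" | "y = t" by linarith
  then show ?thesis
  proof cases
    case 1
    have "((\<lambda>y. (t - y) powr \<delta>) has_real_derivative - (\<delta> * (t - y) powr (\<delta> - 1))) (at y)"
      using 1 by (auto intro!: derivative_eq_intros)
    then have "((\<lambda>y. max 0 (t - y) powr \<delta>) has_real_derivative - (\<delta> * (t - y) powr (\<delta> - 1))) (at y)"
      by (rule has_field_derivative_transform_within_open[where S = "{..<t}"]) (use 1 in auto)
    then show ?thesis by blast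
  next
    case 2
    have "((\<lambda>y. 0) has_real_derivative 0) (at y)" by simp
    then have "((\<lambda>y. max 0 (t - y) powr \<delta>) has_real_derivative 0) (at y)"
      by (rule has_field_derivative_transform_within_open[where S = "{t<..}"]) (use 2 in auto)
    then show ?thesis by blast
  next
    case 3
    have "((\<lambda>y. max 0 (t - y) powr \<delta>) has_real_derivative 0) (at y)"
    proof (rule has_real_derivative_0_quadratic_bound)
      fix h :: real assume "\<bar>h\<bar> \<le> 1"
      then have "max 0 (- h) powr \<delta> \<le> (max 0 (- h))\<^sup>2"
        using assms by (intro powr_le_square) auto
      also have "\<dots> \<le> h\<^sup>2" by (auto simp: max_def)
      finally show "\<bar>max 0 (t - (y + h)) powr \<delta> - max 0 (t - y) powr \<delta>\<bar> \<le> h\<^sup>2"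
        using 3 by simp
    qed
    then show ?thesis by blast
  qed
qed

lemma arccos_cos_abs: "\<bar>\<epsilon>\<bar> \<le> pi \<Longrightarrow> arccos (cos \<epsilon>) = \<bar>\<epsilon>\<bar>"
  using arccos_cos[of "\<bar>\<epsilon>\<bar>"] by simp

text \<open>\<open>arccos\<close> is differentiable only inside the open interval from -1 to 1.
  Distinctness excludes the inner product 1, and the antipodal case is treated directly.\<close>

lemma sphere_kernel_differentiable:
  fixes x y e :: "'a::real_inner"
  assumes unit: "norm x = 1" "norm y = 1" "x \<noteq> y" and e: "x \<bullet> e = 0" and t: "t \<le> pi" and \<delta>: "2 \<le> \<delta>"
  shows "\<exists>D. ((\<lambda>\<epsilon>. sphere_kernel t \<delta> (cos \<epsilon> *\<^sub>R x + sin \<epsilon> *\<^sub>R e) y) has_real_derivative D) (at 0)"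
proof (cases "x \<bullet> y = -1")
  case True
  have "(norm (x + y))\<^sup>2 = 0"
    using True unit by (simp add: power2_norm_eq_inner inner_add_left inner_add_right inner_commute norm_eq_1)
  then have y: "y = - x" by (simp add: add_eq_0_iff)
  have xx: "x \<bullet> x = 1" using unit by (simp add: norm_eq_1)
  \<comment> \<open>Along the curve the distance to the antipode is
    \<open>pi - \<bar>\<epsilon>\<bar>\<close>. With \<open>t\<close> at most \<open>pi\<close> the
    kernel is then bounded by a square.\<close>
  have k: "sphere_kernel t \<delta> (cos \<epsilon> *\<^sub>R x + sin \<epsilon> *\<^sub>R e) y = max 0 (t - pi + \<bar>\<epsilon>\<bar>) powr \<delta>" if "\<bar>\<epsilon>\<bar> \<le> 1" for \<epsilon>
  proof -
    have "\<bar>\<epsilon>\<bar> \<le> pi" using that pi_ge_two by linarith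
    moreover have "(cos \<epsilon> *\<^sub>R x + sin \<epsilon> *\<^sub>R e) \<bullet> y = - cos \<epsilon>"
      using e by (simp add: y inner_add_left xx inner_commute[of e])
    ultimately show ?thesis
      by (simp add: sphere_kernel_def arccos_minus arccos_cos_abs algebra_simps)
  qed
  have "((\<lambda>\<epsilon>. sphere_kernel t \<delta> (cos \<epsilon> *\<^sub>R x + sin \<epsilon> *\<^sub>R e) y) has_real_derivative 0) (at 0)"
  proof (rule has_real_derivative_0_quadratic_bound)
    fix h :: real assume h: "\<bar>h\<bar> \<le> 1"
    have "max 0 (t - pi + \<bar>h\<bar>) powr \<delta> \<le> (max 0 (t - pi + \<bar>h\<bar>))\<^sup>2"
      using h t \<delta> by (intro powr_le_square) auto
    also have "\<dots> \<le> \<bar>h\<bar>\<^sup>2"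
      using t by (intro power_mono) auto
    finally show "\<bar>sphere_kernel t \<delta> (cos (0 + h) *\<^sub>R x + sin (0 + h) *\<^sub>R e) y - sphere_kernel t \<delta> (cos 0 *\<^sub>R x + sin 0 *\<^sub>R e) y\<bar> \<le> h\<^sup>2"
      using h t k[of h] k[of 0] by simp
  qed
  then show ?thesis by blast
next
  case False
  have "x \<bullet> y \<noteq> 1"
  proof
    assume "x \<bullet> y = 1"
    then have "(norm (x - y))\<^sup>2 = 0"
      using unit by (simp add: power2_norm_eq_inner inner_diff_left inner_diff_right inner_commute norm_eq_1)
    then show False using unit by simp
  qed
  moreover have "\<bar>x \<bullet> y\<bar> \<le> 1" using Cauchy_Schwarz_ineq2[of x y] unit by simp
  ultimately have A: "-1 < x \<bullet> y" "x \<bullet> y < 1" using False by auto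
  define g where "g \<epsilon> = cos \<epsilon> * (x \<bullet> y) + sin \<epsilon> * (e \<bullet> y)" for \<epsilon>
  have g: "(g has_real_derivative (e \<bullet> y)) (at 0)"
    unfolding g_def by (auto intro!: derivative_eq_intros)
  have g0: "g 0 = x \<bullet> y" by (simp add: g_def)
  have "(arccos has_real_derivative inverse (- sqrt (1 - (g 0)\<^sup>2))) (at (g 0))"
    unfolding g0 using A by (rule DERIV_arccos)
  then have "((\<lambda>\<epsilon>. arccos (g \<epsilon>)) has_real_derivative inverse (- sqrt (1 - (g 0)\<^sup>2)) * (e \<bullet> y)) (at 0)"
    using g by (rule DERIV_chain2)
  moreover obtain D where "((\<lambda>y. max 0 (t - y) powr \<delta>) has_real_derivative D) (at (arccos (g 0)))"
    using truncated_power_differentiable[OF \<delta>] by blast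
  ultimately have "((\<lambda>\<epsilon>. max 0 (t - arccos (g \<epsilon>)) powr \<delta>) has_real_derivative D * (inverse (- sqrt (1 - (g 0)\<^sup>2)) * (e \<bullet> y))) (at 0)"
    by (rule DERIV_chain2[rotated])
  then show ?thesis
    by (auto simp: sphere_kernel_def g_def inner_add_left)
qed

text \<open>Taking the \<delta>-th root would make \<open>t - \<bar>\<epsilon>\<bar>\<close>
  differentiable at 0. Being a maximum it would have derivative 0, yet its difference quotients have
  absolute value 1.\<close>

lemma not_differentiable_truncated_power_abs:
  fixes t \<delta> D :: real
  assumes t: "0 < t" and \<delta>: "0 < \<delta>"
    and D: "((\<lambda>\<epsilon>. max 0 (t - \<bar>\<epsilon>\<bar>) powr \<delta>) has_real_derivative D) (at 0)"
  shows False
proof -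
  let ?f = "\<lambda>\<epsilon>::real. t - \<bar>\<epsilon>\<bar>"
  have "((\<lambda>\<epsilon>. (max 0 (t - \<bar>\<epsilon>\<bar>) powr \<delta>) powr (1 / \<delta>)) has_real_derivative
     (1 / \<delta> * (max 0 (t - \<bar>0\<bar>) powr \<delta>) powr (1 / \<delta> - 1) * D)) (at 0)"
    using DERIV_fun_powr[OF D, of "1 / \<delta>"] t by simp
  then have "(?f has_real_derivative (1 / \<delta> * (max 0 (t - \<bar>0\<bar>) powr \<delta>) powr (1 / \<delta> - 1) * D)) (at 0)"
    by (rule has_field_derivative_transform_within_open[where S = "{-t<..<t}"]) (use t \<delta> in \<open>auto simp: powr_powr\<close>)
  then obtain L where L: "(?f has_real_derivative L) (at 0)" by blast
  have "L = 0" by (rule DERIV_local_max[OF L, of 1]) auto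
  then have "((\<lambda>h. (?f (0 + h) - ?f 0) / h) \<longlongrightarrow> 0) (at 0)"
    using L by (simp add: DERIV_def)
  then have "((\<lambda>h. norm ((?f (0 + h) - ?f 0) / h)) \<longlongrightarrow> 0) (at 0)"
    by (rule tendsto_norm_zero)
  moreover have "\<forall>\<^sub>F h in at (0::real). norm ((?f (0 + h) - ?f 0) / h) = 1"
    by (rule eventually_at_filter[THEN iffD2]) (auto simp: field_simps)
  ultimately have "((\<lambda>h::real. 1::real) \<longlongrightarrow> 0) (at 0)"
    by (rule Lim_transform_eventually)
  then show False by (simp add: tendsto_const_iff)
qed

lemma sphere_kernel_form_pos:
  fixes x :: "nat \<Rightarrow> 'a::euclidean_space"
  assumes dim: "2 \<le> DIM('a)" and t: "0 < t" "t \<le> pi" and \<delta>: "2 \<le> \<delta>"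
    and nonneg: "\<And>N (x :: nat \<Rightarrow> 'a) c. (\<And>i. i < N \<Longrightarrow> norm (x i) = 1) \<Longrightarrow>
         0 \<le> (\<Sum>i<N. \<Sum>j<N. c i * c j * sphere_kernel t \<delta> (x i) (x j))"
    and unit: "\<And>i. i < N \<Longrightarrow> norm (x i) = 1" and inj: "inj_on x {..<N}" and p: "p < N" "c p \<noteq> 0"
  shows "0 < (\<Sum>i<N. \<Sum>j<N. c i * c j * sphere_kernel t \<delta> (x i) (x j))"
proof (rule ccontr)
  assume "\<not> ?thesis"
  moreover have "0 \<le> (\<Sum>i<N. \<Sum>j<N. c i * c j * sphere_kernel t \<delta> (x i) (x j))"
    by (intro nonneg unit)
  ultimately have Q: "(\<Sum>i<N. \<Sum>j<N. c i * c j * sphere_kernel t \<delta> (x i) (x j)) = 0"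
    by linarith
  \<comment> \<open>Cauchy-Schwarz by adjoining \<open>y\<close> as one more point with coefficient
    \<open>l\<close>. The assumption \<open>nonneg\<close> allows repeated points, so
    \<open>y\<close> may be one of the \<open>x j\<close>.\<close>
  have zero: "(\<Sum>j<N. c j * sphere_kernel t \<delta> y (x j)) = 0" if y: "norm y = 1" for y
  proof -
    define S where "S = (\<Sum>j<N. c j * sphere_kernel t \<delta> y (x j))"
    define T where "T = t powr \<delta>"
    have T: "sphere_kernel t \<delta> y y = T" "0 < T"
      using y t by (simp_all add: sphere_kernel_def T_def norm_eq_1)
    \<comment> \<open>The minimiser of \<open>2 * l * S + l * l * T\<close>, with minimum
      \<open>- (S * S / T)\<close>.\<close>
    define l where "l = - S / T"
    let ?x = "x(N := y)" and ?c = "c(N := l)"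
    have "0 \<le> (\<Sum>i<Suc N. \<Sum>j<Suc N. ?c i * ?c j * sphere_kernel t \<delta> (?x i) (?x j))"
      using unit y by (intro nonneg) auto
    also have "\<dots> = (\<Sum>i<N. \<Sum>j<N. c i * c j * sphere_kernel t \<delta> (x i) (x j)) +
        (\<Sum>i<N. l * (c i * sphere_kernel t \<delta> y (x i))) + (\<Sum>j<N. l * (c j * sphere_kernel t \<delta> y (x j))) + l * l * T"
    proof -
      have "(\<Sum>i<Suc N. \<Sum>j<Suc N. ?c i * ?c j * sphere_kernel t \<delta> (?x i) (?x j)) =
        (\<Sum>i<N. (\<Sum>j<N. c i * c j * sphere_kernel t \<delta> (x i) (x j)) + c i * l * sphere_kernel t \<delta> (x i) y) +
        ((\<Sum>j<N. l * c j * sphere_kernel t \<delta> y (x j)) + l * l * T)"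
        unfolding sum.lessThan_Suc
        by (intro arg_cong2[where f = "(+)"] sum.cong refl) (auto simp: T)
      moreover have "c i * l * sphere_kernel t \<delta> (x i) y = l * (c i * sphere_kernel t \<delta> y (x i))" for i
        using sphere_kernel_commute[of t \<delta> "x i" y] by simp
      ultimately show ?thesis
        by (simp only: sum.distrib add.assoc mult.assoc)
    qed
    also have "\<dots> = 2 * l * S + l * l * T"
      unfolding Q S_def sum_distrib_left[symmetric] by simp
    also have "\<dots> = - (S * S / T)"
      using T by (simp add: l_def field_simps)
    finally have "S * S / T \<le> 0" by simp
    then have "S * S \<le> 0" using T by (simp add: divide_le_0_iff)
    then have "S = 0" by (auto simp: mult_le_0_iff)
    then show ?thesis by (simp add: S_def)
  qed
  obtain e0 where e0: "e0 \<noteq> 0" "x p \<bullet> e0 = 0"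
    using orthogonal_to_vector_exists[OF dim] unfolding real_inner_class.orthogonal_def by blast
  define e where "e = e0 /\<^sub>R norm e0"
  have e: "norm e = 1" "x p \<bullet> e = 0"
    using e0 by (auto simp: e_def)
  have xp: "x p \<bullet> x p = 1" using unit p by (simp add: norm_eq_1)
  define \<gamma> where "\<gamma> \<epsilon> = cos \<epsilon> *\<^sub>R x p + sin \<epsilon> *\<^sub>R e" for \<epsilon>
  have \<gamma>1: "norm (\<gamma> \<epsilon>) = 1" for \<epsilon>
  proof -
    have "\<gamma> \<epsilon> \<bullet> \<gamma> \<epsilon> = cos \<epsilon> * cos \<epsilon> + sin \<epsilon> * sin \<epsilon>"
      using e xp by (simp add: \<gamma>_def inner_add_left inner_add_right inner_commute norm_eq_1)
    also have "\<dots> = 1" using sin_cos_squared_add2[of \<epsilon>] by (simp add: power2_eq_square)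
    finally show ?thesis by (simp add: norm_eq_1)
  qed
  have "\<exists>D. ((\<lambda>\<epsilon>. sphere_kernel t \<delta> (\<gamma> \<epsilon>) (x j)) has_real_derivative D) (at 0)" if "j \<in> {..<N} - {p}" for j
    unfolding \<gamma>_def using that p inj unit e t \<delta> by (intro sphere_kernel_differentiable) (auto simp: inj_on_def)
  then obtain D where D: "\<And>j. j \<in> {..<N} - {p} \<Longrightarrow> ((\<lambda>\<epsilon>. sphere_kernel t \<delta> (\<gamma> \<epsilon>) (x j)) has_real_derivative D j) (at 0)"
    by metis
  \<comment> \<open>Solving \<open>zero\<close> along the curve for the term with index
    \<open>p\<close> expresses it through differentiable terms.\<close>
  have "((\<lambda>\<epsilon>. - (\<Sum>j\<in>{..<N} - {p}. c j * sphere_kernel t \<delta> (\<gamma> \<epsilon>) (x j)) / c p) has_real_derivative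
     - (\<Sum>j\<in>{..<N} - {p}. c j * D j) / c p) (at 0)"
    by (intro DERIV_cdivide DERIV_minus DERIV_sum DERIV_cmult D)
  moreover have "- (\<Sum>j\<in>{..<N} - {p}. c j * sphere_kernel t \<delta> (\<gamma> \<epsilon>) (x j)) / c p = sphere_kernel t \<delta> (\<gamma> \<epsilon>) (x p)" for \<epsilon>
    using zero[OF \<gamma>1[of \<epsilon>]] p by (simp add: sum.remove[of "{..<N}" p] field_simps)
  ultimately have "((\<lambda>\<epsilon>. sphere_kernel t \<delta> (\<gamma> \<epsilon>) (x p)) has_real_derivative - (\<Sum>j\<in>{..<N} - {p}. c j * D j) / c p) (at 0)"
    by simp
  then have "((\<lambda>\<epsilon>. max 0 (t - \<bar>\<epsilon>\<bar>) powr \<delta>) has_real_derivative - (\<Sum>j\<in>{..<N} - {p}. c j * D j) / c p) (at 0)"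
  proof (rule has_field_derivative_transform_within_open[where S = "{-pi<..<pi}"])
    fix \<epsilon> assume "\<epsilon> \<in> {-pi<..<pi}"
    then have "\<bar>\<epsilon>\<bar> \<le> pi" by auto
    moreover have "\<gamma> \<epsilon> \<bullet> x p = cos \<epsilon>"
      using e xp by (simp add: \<gamma>_def inner_add_left inner_commute[of e])
    ultimately show "sphere_kernel t \<delta> (\<gamma> \<epsilon>) (x p) = max 0 (t - \<bar>\<epsilon>\<bar>) powr \<delta>"
      by (simp add: sphere_kernel_def arccos_cos_abs)
  qed auto
  then show False
    using not_differentiable_truncated_power_abs t \<delta> by fastforce
qed

section \<open>Embedding into even dimension\<close>

text \<open>The invariance of Lebesgue measure under orthogonal maps is available in the library only for
  well-ordered index types, so an index type of the required even cardinality is built from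
  initial segments of the naturals.\<close>

typedef 'n even_index = "{..<2 * ((CARD('n::finite) + 1) div 2)}"
proof
  show "0 \<in> {..<2 * ((CARD('n) + 1) div 2)}"
    using zero_less_card_finite[where 'a = 'n] by (simp add: div_greater_zero_iff)
qed

lemma card_even_index: "CARD('n::finite even_index) = 2 * ((CARD('n) + 1) div 2)"
  unfolding type_definition.card[OF type_definition_even_index] by simp

instance even_index :: (finite) finite
proof
  \<comment> \<open>An infinite type has \<open>CARD\<close> equal to 0, so a positive cardinality
    proves finiteness.\<close>
  have "0 < CARD('a even_index)"
    using zero_less_card_finite[where 'a = 'a] by (simp add: card_even_index div_greater_zero_iff)
  then show "finite (UNIV :: 'a even_index set)"
    by (rule card_ge_0_finite)
qed

instantiation even_index :: (finite) wellorder
begin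

definition "x \<le> y \<longleftrightarrow> Rep_even_index x \<le> Rep_even_index y"

definition "x < y \<longleftrightarrow> Rep_even_index x < Rep_even_index y"

instance
proof
  fix P :: "'a even_index \<Rightarrow> bool" and a :: "'a even_index"
  assume step: "\<And>x. (\<And>y. y < x \<Longrightarrow> P y) \<Longrightarrow> P x"
  show "P a"
    by (induction a rule: measure_induct_rule[of Rep_even_index]) (auto intro: step simp: less_even_index_def)
qed (auto simp: less_eq_even_index_def less_even_index_def Rep_even_index_inject)

end

text \<open>The target has at least the dimension of the source, so a norm-preserving linear map
  exists; by polarization it preserves inner products.\<close>

lemma isometric_embedding_even_index:
  obtains f :: "real^'n::finite \<Rightarrow> real^('n even_index)" where "\<And>x y. f x \<bullet> f y = x \<bullet> y"
proof -
  have "dim (UNIV :: (real^'n) set) \<le> dim (UNIV :: (real^('n even_index)) set)"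
    by (simp add: card_even_index)
  then obtain f :: "real^'n \<Rightarrow> real^('n even_index)" where f: "linear f" "\<And>x. norm (f x) = norm x"
    using isometry_subset_subspace[of "UNIV :: (real^'n) set" "UNIV :: (real^('n even_index)) set"]
    by (metis UNIV_I subspace_UNIV)
  have "f x \<bullet> f y = x \<bullet> y" for x y
    unfolding dot_norm by (simp add: f(2) flip: linear_add[OF f(1)])
  then show thesis using that by blast
qed

text \<open>The form depends on the points only through their inner products, so it is unchanged by
  the embedding into even dimension.\<close>

lemma sphere_kernel_form_nonneg:
  fixes x :: "nat \<Rightarrow> real^'n::finite"
  assumes "CARD('n) \<ge> 3" "0 < t" "t \<le> pi" "real ((CARD('n) + 1) div 2) \<le> \<delta>"
    and "\<And>i. i < N \<Longrightarrow> norm (x i) = 1"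
  shows "0 \<le> (\<Sum>i<N. \<Sum>j<N. c i * c j * sphere_kernel t \<delta> (x i) (x j))"
proof -
  obtain f :: "real^'n \<Rightarrow> real^('n even_index)" where f: "\<And>x y. f x \<bullet> f y = x \<bullet> y"
    using isometric_embedding_even_index by blast
  have "0 \<le> (\<Sum>i<N. \<Sum>j<N. c i * c j * max 0 (t - arccos (f (x i) \<bullet> f (x j))) powr \<delta>)"
    using assms f by (intro truncated_form_nonneg_even[OF card_even_index]) (auto simp: norm_eq_1)
  then show ?thesis by (simp add: f sphere_kernel_def)
qed

section \<open>From quadratic forms to the matrix statement\<close>

lemma le_ceiling_half: "real ((n + 1) div 2) \<le> of_int \<lceil>real n / 2\<rceil>"
proof -
  have "real n / 2 \<le> of_int \<lceil>real n / 2\<rceil>" by (rule le_of_int_ceiling)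
  then have "real n \<le> 2 * of_int \<lceil>real n / 2\<rceil>" by linarith
  then have "int n \<le> 2 * \<lceil>real n / 2\<rceil>" by linarith
  then have "int ((n + 1) div 2) \<le> \<lceil>real n / 2\<rceil>" by linarith
  then show ?thesis by linarith
qed

lemma truncated_power_eq: "truncated_power t \<delta> \<theta> = max 0 (t - \<theta>) powr \<delta>"
  by (simp add: truncated_power_def max_def)

lemma positive_definite_kernel_mat:
  assumes sym: "\<And>i j. K i j = K j i"
    and pos: "\<And>c p. p < N \<Longrightarrow> c p \<noteq> 0 \<Longrightarrow> 0 < (\<Sum>i<N. \<Sum>j<N. c i * c j * K i j)"
  shows "positive_definite_mat (Matrix.mat N N (\<lambda>(i, j). K i j))"
  unfolding positive_definite_mat_def
proof (intro conjI ballI impI)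
  let ?A = "Matrix.mat N N (\<lambda>(i, j). K i j)"
  show "square_mat ?A" by simp
  show "transpose_mat ?A = ?A" using sym by (intro eq_matI) auto
  fix v :: "real Matrix.vec" assume v: "v \<in> carrier_vec (dim_row ?A)" "v \<noteq> 0\<^sub>v (dim_row ?A)"
  then have "dim_vec v = N" by simp
  then obtain p where p: "p < N" "vec_index v p \<noteq> 0"
    using v(2) by (auto simp: vec_eq_iff)
  have "scalar_prod v (?A *\<^sub>v v) = (\<Sum>i<N. \<Sum>j<N. vec_index v i * vec_index v j * K i j)"
    using \<open>dim_vec v = N\<close>
    by (auto simp: scalar_prod_def atLeast0LessThan sum_distrib_left mult_ac intro!: sum.cong)
  also have "\<dots> > 0" using p by (intro pos[of p "vec_index v"])
  finally show "0 < scalar_prod v (?A *\<^sub>v v)" .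
qed

theorem corollary2p2:
  fixes t \<delta> :: real
  assumes "CARD('n::finite) \<ge> 3"
    and "0 < t" and "t \<le> pi"
    and "\<delta> \<ge> of_int \<lceil>real CARD('n) / 2\<rceil>"
  shows "strictly_positive_definite_sphere TYPE('n) (\<lambda>\<theta>. truncated_power t \<delta> \<theta>)"
  unfolding strictly_positive_definite_sphere_def
proof (intro conjI allI impI)
  have k: "real ((CARD('n) + 1) div 2) \<le> \<delta>"
    using le_ceiling_half assms(4) by (rule order_trans)
  \<comment> \<open>Dimension at least 3 makes half the even dimension at least 2, hence the
    exponent at least 2, as the differentiability argument requires.\<close>
  moreover have "2 \<le> (CARD('n) + 1) div 2" using assms(1) by simp
  ultimately have \<delta>: "2 \<le> \<delta>" by linarith
  show "continuous_on {0..pi} (\<lambda>\<theta>. truncated_power t \<delta> \<theta>)"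
    unfolding truncated_power_eq using \<delta> by (intro continuous_on_powr' continuous_intros) auto
  fix N :: nat and x :: "nat \<Rightarrow> real^'n"
  assume "(\<forall>i<N. x i \<in> sphere 0 1) \<and> inj_on x {..<N}"
  then have unit: "\<And>i. i < N \<Longrightarrow> norm (x i) = 1" and inj: "inj_on x {..<N}" by auto
  have K: "truncated_power t \<delta> (geodesic_dist y z) = sphere_kernel t \<delta> y z" for y z :: "real^'n"
    by (simp add: truncated_power_eq geodesic_dist_def sphere_kernel_def)
  show "positive_definite_mat (Matrix.mat N N (\<lambda>(i, j). truncated_power t \<delta> (geodesic_dist (x i) (x j))))"
    unfolding K
  proof (rule positive_definite_kernel_mat)
    fix c :: "nat \<Rightarrow> real" and p assume "p < N" "c p \<noteq> 0"
    then show "0 < (\<Sum>i<N. \<Sum>j<N. c i * c j * sphere_kernel t \<delta> (x i) (x j))"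
      using assms(1-3) k \<delta> unit inj
      by (intro sphere_kernel_form_pos[where p = p] sphere_kernel_form_nonneg) auto
  qed (rule sphere_kernel_commute)
qed

end
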